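(* Let $A$ be a commutative ring, let $U\subseteq A[X]$ be a multiplicatively closed subset, and let $I\subseteq A[X]_U$ be an ideal such that the residue ring $A[X]_U/I$ is a free $A$-module of rank $n$. Then there exists a unique monic polynomial $F(X)$ in $A[X]$ of degree $n$ whose image in $A[X]_U$ generates the ideal $I$. In particular the canonical map $A[X]/(F(X))\to A[X]_U/I$ is an isomorphism.
   Context: $A[X]$ is the polynomial ring in one variable $X$ over $A$, and $A[X]_U$ is the fraction ring (localization) of $A[X]$ with respect to $U$. *)

theory Defs
  imports "HOL-Algebra.UnivPoly" "HOL-Algebra.QuotRing"
begin

section \<open>Localization of a commutative ring\<close>

text \<open>The factor \<open>t\<close> is needed because the multiplicative set may contain zero divisors
  (or even zero, in which case the localization is the zero ring).\<close>

definition loc_rel :: "('b, 'm) ring_scheme \<Rightarrow> 'b set \<Rightarrow> (('b \<times> 'b) \<times> ('b \<times> 'b)) set" where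
  "loc_rel R S =
    {((a, s), (b, u)) | a s b u. a \<in> carrier R \<and> s \<in> S \<and> b \<in> carrier R \<and> u \<in> S \<and>
       (\<exists>t\<in>S. t \<otimes>\<^bsub>R\<^esub> (a \<otimes>\<^bsub>R\<^esub> u) = t \<otimes>\<^bsub>R\<^esub> (b \<otimes>\<^bsub>R\<^esub> s))}"

definition fraction :: "('b, 'm) ring_scheme \<Rightarrow> 'b set \<Rightarrow> 'b \<Rightarrow> 'b \<Rightarrow> ('b \<times> 'b) set" where
  "fraction R S a s = loc_rel R S `` {(a, s)}"

text \<open>The union over all representatives is the class of any single one of them,
  cf. \<open>fraction_mult\<close> and \<open>fraction_add\<close> below.\<close>

definition localization :: "('b, 'm) ring_scheme \<Rightarrow> 'b set \<Rightarrow> ('b \<times> 'b) set ring" where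
  "localization R S = \<lparr>
     carrier = (carrier R \<times> S) // loc_rel R S,
     mult = (\<lambda>x y. \<Union>(a, s)\<in>x. \<Union>(b, u)\<in>y. fraction R S (a \<otimes>\<^bsub>R\<^esub> b) (s \<otimes>\<^bsub>R\<^esub> u)),
     one = fraction R S \<one>\<^bsub>R\<^esub> \<one>\<^bsub>R\<^esub>,
     zero = fraction R S \<zero>\<^bsub>R\<^esub> \<one>\<^bsub>R\<^esub>,
     add = (\<lambda>x y. \<Union>(a, s)\<in>x. \<Union>(b, u)\<in>y.
              fraction R S ((a \<otimes>\<^bsub>R\<^esub> u) \<oplus>\<^bsub>R\<^esub> (b \<otimes>\<^bsub>R\<^esub> s)) (s \<otimes>\<^bsub>R\<^esub> u)) \<rparr>"

definition loc_map :: "('b, 'm) ring_scheme \<Rightarrow> 'b set \<Rightarrow> 'b \<Rightarrow> ('b \<times> 'b) set" where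
  "loc_map R S a = fraction R S a \<one>\<^bsub>R\<^esub>"

section \<open>Free modules of finite rank\<close>

text \<open>A ring \<open>B\<close> as a module over \<open>R\<close> by way of a ring homomorphism \<open>h\<close> from \<open>R\<close> to \<open>B\<close>.\<close>

definition module_via :: "('a \<Rightarrow> 'b) \<Rightarrow> ('b, 'm) ring_scheme \<Rightarrow> ('a, 'b) module" where
  "module_via h B = \<lparr>
     carrier = carrier B, mult = mult B, one = one B, zero = zero B, add = add B,
     smult = (\<lambda>a x. h a \<otimes>\<^bsub>B\<^esub> x) \<rparr>"

text \<open>A basis is an indexed family, not a set: over the zero ring the zero module
  is free of every rank.\<close>

definition is_basis :: "('a, 'm) ring_scheme \<Rightarrow> ('a, 'b, 'k) module_scheme \<Rightarrow> nat \<Rightarrow> (nat \<Rightarrow> 'b) \<Rightarrow> bool" where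
  "is_basis R M n e \<longleftrightarrow>
     e \<in> {..<n} \<rightarrow> carrier M \<and>
     (\<forall>x\<in>carrier M. \<exists>c \<in> {..<n} \<rightarrow> carrier R. x = (\<Oplus>\<^bsub>M\<^esub>i\<in>{..<n}. c i \<odot>\<^bsub>M\<^esub> e i)) \<and>
     (\<forall>c \<in> {..<n} \<rightarrow> carrier R.
        (\<Oplus>\<^bsub>M\<^esub>i\<in>{..<n}. c i \<odot>\<^bsub>M\<^esub> e i) = \<zero>\<^bsub>M\<^esub> \<longrightarrow> (\<forall>i<n. c i = \<zero>\<^bsub>R\<^esub>))"

definition free_of_rank :: "('a, 'm) ring_scheme \<Rightarrow> ('a, 'b, 'k) module_scheme \<Rightarrow> nat \<Rightarrow> bool" where
  "free_of_rank R M n \<longleftrightarrow> module R M \<and> (\<exists>e. is_basis R M n e)"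

section \<open>Polynomials and residue rings of a localized polynomial ring\<close>

text \<open>For nonzero \<open>R\<close> this says \<open>deg R F = n\<close> with leading coefficient one, see
  \<open>monic_of_degree_iff\<close> below. The inequality is there for the zero ring, where
  \<open>deg\<close> is constantly zero although the zero polynomial equals \<open>X\<^sup>n\<close> for every \<open>n\<close>.\<close>

definition monic_of_degree :: "('a, 'm) ring_scheme \<Rightarrow> nat \<Rightarrow> (nat \<Rightarrow> 'a) \<Rightarrow> bool" where
  "monic_of_degree R n F \<longleftrightarrow>
     F \<in> carrier (UP R) \<and> deg R F \<le> n \<and> coeff (UP R) F n = \<one>\<^bsub>R\<^esub>"

abbreviation UP_loc :: "('a, 'm) ring_scheme \<Rightarrow> (nat \<Rightarrow> 'a) set \<Rightarrow> ((nat \<Rightarrow> 'a) \<times> (nat \<Rightarrow> 'a)) set ring" where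
  "UP_loc R U \<equiv> localization (UP R) U"

text \<open>The canonical homomorphism from \<open>R[X]\<close> to the residue ring of \<open>R[X]\<^sub>U\<close> modulo \<open>I\<close>.\<close>

definition residue_map :: "('a, 'm) ring_scheme \<Rightarrow> (nat \<Rightarrow> 'a) set
    \<Rightarrow> ((nat \<Rightarrow> 'a) \<times> (nat \<Rightarrow> 'a)) set set
    \<Rightarrow> (nat \<Rightarrow> 'a) \<Rightarrow> ((nat \<Rightarrow> 'a) \<times> (nat \<Rightarrow> 'a)) set set" where
  "residue_map R U I p = I +>\<^bsub>UP_loc R U\<^esub> loc_map (UP R) U p"

definition residue_module :: "('a, 'm) ring_scheme \<Rightarrow> (nat \<Rightarrow> 'a) set
    \<Rightarrow> ((nat \<Rightarrow> 'a) \<times> (nat \<Rightarrow> 'a)) set set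
    \<Rightarrow> ('a, ((nat \<Rightarrow> 'a) \<times> (nat \<Rightarrow> 'a)) set set) module" where
  "residue_module R U I =
     module_via (\<lambda>a. residue_map R U I (monom (UP R) a 0)) (UP_loc R U Quot I)"

text \<open>The map induced by \<open>residue_map\<close> on residue classes of polynomials, in the style of
  \<open>ring_hom_ring.FactRing_iso_set\<close>. It is meaningful only if
  \<open>residue_map\<close> is constant on the classes in question, cf. \<open>induced_residue_map_eq\<close> below.\<close>

definition induced_residue_map :: "('a, 'm) ring_scheme \<Rightarrow> (nat \<Rightarrow> 'a) set
    \<Rightarrow> ((nat \<Rightarrow> 'a) \<times> (nat \<Rightarrow> 'a)) set set
    \<Rightarrow> (nat \<Rightarrow> 'a) set \<Rightarrow> ((nat \<Rightarrow> 'a) \<times> (nat \<Rightarrow> 'a)) set set" where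
  "induced_residue_map R U I C = the_elem (residue_map R U I ` C)"

section \<open>Basic facts\<close>

locale cring_with_submonoid = cring R + submonoid S R for R (structure) and S
begin

lemma S_carrier: "s \<in> S \<Longrightarrow> s \<in> carrier R"
  using subset by blast

lemma loc_rel_iff:
  "((a, s), (b, u)) \<in> loc_rel R S \<longleftrightarrow>
     a \<in> carrier R \<and> s \<in> S \<and> b \<in> carrier R \<and> u \<in> S \<and>
     (\<exists>t\<in>S. t \<otimes> (a \<otimes> u) = t \<otimes> (b \<otimes> s))"
  by (auto simp: loc_rel_def)

lemma loc_rel_mem:
  assumes "((a, s), (b, u)) \<in> loc_rel R S"
  shows "a \<in> carrier R" "s \<in> S" "b \<in> carrier R" "u \<in> S"
  using assms unfolding loc_rel_iff by blast+

lemma equiv_loc_rel: "equiv (carrier R \<times> S) (loc_rel R S)"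
proof (rule equivI)
  show "loc_rel R S \<subseteq> (carrier R \<times> S) \<times> (carrier R \<times> S)"
    by (auto simp: loc_rel_def)
  show "refl_on (carrier R \<times> S) (loc_rel R S)"
    using one_closed by (auto simp: refl_on_def loc_rel_iff)
  show "sym (loc_rel R S)"
    unfolding sym_def by (clarsimp simp: loc_rel_iff) metis
  show "trans (loc_rel R S)"
  proof (rule transI)
    fix x y z assume xy: "(x, y) \<in> loc_rel R S" and yz: "(y, z) \<in> loc_rel R S"
    obtain a s b u c v where x: "x = (a, s)" and y: "y = (b, u)" and z: "z = (c, v)"
      by (metis prod.exhaust)
    from xy obtain t where t: "t \<in> S" "t \<otimes> (a \<otimes> u) = t \<otimes> (b \<otimes> s)"
      unfolding x y loc_rel_iff by blast
    from yz obtain w where w: "w \<in> S" "w \<otimes> (b \<otimes> v) = w \<otimes> (c \<otimes> u)"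
      unfolding z y loc_rel_iff by blast
    have mem: "a \<in> carrier R" "s \<in> S" "b \<in> carrier R" "u \<in> S" "c \<in> carrier R" "v \<in> S"
      using loc_rel_mem[OF xy[unfolded x y]] loc_rel_mem[OF yz[unfolded y z]] by blast+
    have car: "a \<in> carrier R" "s \<in> carrier R" "b \<in> carrier R" "u \<in> carrier R"
      "c \<in> carrier R" "v \<in> carrier R" "t \<in> carrier R" "w \<in> carrier R"
      using mem t(1) w(1) S_carrier by auto
    have "(t \<otimes> w \<otimes> u) \<otimes> (a \<otimes> v) = (t \<otimes> (a \<otimes> u)) \<otimes> (w \<otimes> v)"
      using car by (simp add: m_ac)
    also have "\<dots> = (w \<otimes> (b \<otimes> v)) \<otimes> (t \<otimes> s)"
      using car t(2) by (simp add: m_ac)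
    also have "\<dots> = (t \<otimes> w \<otimes> u) \<otimes> (c \<otimes> s)"
      using car w(2) by (simp add: m_ac)
    finally show "(x, z) \<in> loc_rel R S"
      unfolding x z loc_rel_iff using mem t(1) w(1) by blast
  qed
qed

lemma fraction_eq_iff:
  assumes "a \<in> carrier R" "s \<in> S" "b \<in> carrier R" "u \<in> S"
  shows "fraction R S a s = fraction R S b u \<longleftrightarrow> (\<exists>t\<in>S. t \<otimes> (a \<otimes> u) = t \<otimes> (b \<otimes> s))"
  unfolding fraction_def using eq_equiv_class_iff[OF equiv_loc_rel, of "(a, s)" "(b, u)"] assms
  by (simp add: loc_rel_iff)

lemma fraction_closed [intro]:
  "a \<in> carrier R \<Longrightarrow> s \<in> S \<Longrightarrow> fraction R S a s \<in> carrier (localization R S)"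
  by (simp add: localization_def fraction_def quotientI)

lemma carrier_localizationE:
  assumes "x \<in> carrier (localization R S)"
  obtains a s where "a \<in> carrier R" "s \<in> S" "x = fraction R S a s"
  using assms by (auto simp: localization_def fraction_def elim!: quotientE)

lemma fraction_mult:
  assumes "a \<in> carrier R" "s \<in> S" "b \<in> carrier R" "u \<in> S"
  shows "fraction R S a s \<otimes>\<^bsub>localization R S\<^esub> fraction R S b u = fraction R S (a \<otimes> b) (s \<otimes> u)"
proof -
  have "(\<lambda>x y. case x of (a, s) \<Rightarrow> case y of (b, u) \<Rightarrow> fraction R S (a \<otimes> b) (s \<otimes> u))
          respects2 loc_rel R S"
  proof (rule congruent2_commuteI[OF equiv_loc_rel])
    fix y z assume "y \<in> carrier R \<times> S" "z \<in> carrier R \<times> S"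
    then show "(case y of (a, s) \<Rightarrow> case z of (b, u) \<Rightarrow> fraction R S (a \<otimes> b) (s \<otimes> u)) =
      (case z of (a, s) \<Rightarrow> case y of (b, u) \<Rightarrow> fraction R S (a \<otimes> b) (s \<otimes> u))"
      using S_carrier by (auto simp: m_comm)
  next
    fix y z w assume w: "w \<in> carrier R \<times> S" and yz: "(y, z) \<in> loc_rel R S"
    obtain a s b u c v where y: "y = (a, s)" and z: "z = (b, u)" and cv: "w = (c, v)"
      by (metis prod.exhaust)
    from yz obtain t where t: "t \<in> S" "t \<otimes> (a \<otimes> u) = t \<otimes> (b \<otimes> s)"
      unfolding y z loc_rel_iff by blast
    have mem: "a \<in> carrier R" "s \<in> S" "b \<in> carrier R" "u \<in> S" "c \<in> carrier R" "v \<in> S"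
      using w loc_rel_mem[OF yz[unfolded y z]] unfolding cv by blast+
    have car: "s \<in> carrier R" "u \<in> carrier R" "v \<in> carrier R" "t \<in> carrier R"
      using mem t(1) S_carrier by auto
    have "t \<otimes> ((c \<otimes> a) \<otimes> (v \<otimes> u)) = (t \<otimes> (a \<otimes> u)) \<otimes> (c \<otimes> v)"
      using car mem by (simp add: m_ac)
    also have "\<dots> = t \<otimes> ((c \<otimes> b) \<otimes> (v \<otimes> s))"
      using car mem t(2) by (simp add: m_ac)
    finally show "(case w of (a, s) \<Rightarrow> case y of (b, u) \<Rightarrow> fraction R S (a \<otimes> b) (s \<otimes> u)) =
      (case w of (a, s) \<Rightarrow> case z of (b, u) \<Rightarrow> fraction R S (a \<otimes> b) (s \<otimes> u))"
      unfolding y z cv using mem t(1) by (auto simp: fraction_eq_iff)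
  qed
  from UN_equiv_class2[OF equiv_loc_rel equiv_loc_rel this, of "(a, s)" "(b, u)"] assms
  show ?thesis by (simp add: localization_def fraction_def case_prod_unfold)
qed

lemma fraction_add:
  assumes "a \<in> carrier R" "s \<in> S" "b \<in> carrier R" "u \<in> S"
  shows "fraction R S a s \<oplus>\<^bsub>localization R S\<^esub> fraction R S b u =
    fraction R S ((a \<otimes> u) \<oplus> (b \<otimes> s)) (s \<otimes> u)"
proof -
  let ?f = "\<lambda>x y. case x of (a, s) \<Rightarrow> case y of (b, u) \<Rightarrow> fraction R S ((a \<otimes> u) \<oplus> (b \<otimes> s)) (s \<otimes> u)"
  have "?f respects2 loc_rel R S"
  proof (rule congruent2_commuteI[OF equiv_loc_rel])
    fix y z assume "y \<in> carrier R \<times> S" "z \<in> carrier R \<times> S"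
    then show "?f y z = ?f z y"
      using S_carrier by (auto simp: m_comm a_comm)
  next
    fix y z w assume w: "w \<in> carrier R \<times> S" and yz: "(y, z) \<in> loc_rel R S"
    obtain a s b u c v where y: "y = (a, s)" and z: "z = (b, u)" and cv: "w = (c, v)"
      by (metis prod.exhaust)
    from yz obtain t where t: "t \<in> S" "t \<otimes> (a \<otimes> u) = t \<otimes> (b \<otimes> s)"
      unfolding y z loc_rel_iff by blast
    have mem: "a \<in> carrier R" "s \<in> S" "b \<in> carrier R" "u \<in> S" "c \<in> carrier R" "v \<in> S"
      using w loc_rel_mem[OF yz[unfolded y z]] unfolding cv by blast+
    have car: "s \<in> carrier R" "u \<in> carrier R" "v \<in> carrier R" "t \<in> carrier R"
      using mem t(1) S_carrier by auto
    have "t \<otimes> (((c \<otimes> s) \<oplus> (a \<otimes> v)) \<otimes> (v \<otimes> u)) =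
          (t \<otimes> (c \<otimes> s \<otimes> v \<otimes> u)) \<oplus> ((t \<otimes> (a \<otimes> u)) \<otimes> (v \<otimes> v))"
      using car mem by (simp add: m_ac l_distr r_distr)
    also have "\<dots> = t \<otimes> (((c \<otimes> u) \<oplus> (b \<otimes> v)) \<otimes> (v \<otimes> s))"
      using car mem unfolding t(2) by (simp add: m_ac l_distr r_distr)
    finally show "?f w y = ?f w z"
      unfolding y z cv using mem car t(1) by (auto simp: fraction_eq_iff)
  qed
  from UN_equiv_class2[OF equiv_loc_rel equiv_loc_rel this, of "(a, s)" "(b, u)"] assms
  show ?thesis by (simp add: localization_def fraction_def case_prod_unfold)
qed

lemma localization_zero: "\<zero>\<^bsub>localization R S\<^esub> = fraction R S \<zero> \<one>"
  and localization_one: "\<one>\<^bsub>localization R S\<^esub> = fraction R S \<one> \<one>"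
  by (simp_all add: localization_def)

lemma fraction_eqI:
  assumes "a \<in> carrier R" "s \<in> S" "b \<in> carrier R" "u \<in> S" "a \<otimes> u = b \<otimes> s"
  shows "fraction R S a s = fraction R S b u"
  using assms one_closed by (auto simp: fraction_eq_iff)

lemma cring_localization: "cring (localization R S)"
proof (rule cringI)
  let ?L = "localization R S"
  note frac = fraction_mult fraction_add localization_zero localization_one S_carrier
  show "abelian_group ?L"
  proof (rule abelian_groupI)
    fix x y assume "x \<in> carrier ?L" "y \<in> carrier ?L"
    then show "x \<oplus>\<^bsub>?L\<^esub> y \<in> carrier ?L"
      by (elim carrier_localizationE) (auto simp: frac intro!: fraction_closed)
  next
    show "\<zero>\<^bsub>?L\<^esub> \<in> carrier ?L" by (auto simp: frac)
  next
    fix x y z assume "x \<in> carrier ?L" "y \<in> carrier ?L" "z \<in> carrier ?L"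
    then show "x \<oplus>\<^bsub>?L\<^esub> y \<oplus>\<^bsub>?L\<^esub> z = x \<oplus>\<^bsub>?L\<^esub> (y \<oplus>\<^bsub>?L\<^esub> z)"
      by (elim carrier_localizationE)
        (auto simp: frac l_distr r_distr m_ac a_ac intro!: fraction_eqI)
  next
    fix x y assume "x \<in> carrier ?L" "y \<in> carrier ?L"
    then show "x \<oplus>\<^bsub>?L\<^esub> y = y \<oplus>\<^bsub>?L\<^esub> x"
      by (elim carrier_localizationE) (auto simp: frac m_comm a_comm)
  next
    fix x assume "x \<in> carrier ?L"
    then show "\<zero>\<^bsub>?L\<^esub> \<oplus>\<^bsub>?L\<^esub> x = x"
      by (elim carrier_localizationE) (auto simp: frac intro!: fraction_eqI)
  next
    fix x assume "x \<in> carrier ?L"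
    then obtain a s where as: "a \<in> carrier R" "s \<in> S" "x = fraction R S a s"
      by (elim carrier_localizationE)
    have "fraction R S (\<ominus> a) s \<oplus>\<^bsub>?L\<^esub> x = \<zero>\<^bsub>?L\<^esub>"
    proof -
      have "fraction R S (\<ominus> a) s \<oplus>\<^bsub>?L\<^esub> x = fraction R S \<zero> (s \<otimes> s)"
        using as S_carrier by (simp add: frac l_minus l_neg)
      also have "\<dots> = fraction R S \<zero> \<one>"
        using as S_carrier by (intro fraction_eqI) auto
      finally show ?thesis by (simp add: localization_zero)
    qed
    then show "\<exists>y\<in>carrier ?L. y \<oplus>\<^bsub>?L\<^esub> x = \<zero>\<^bsub>?L\<^esub>"
      using as by blast
  qed
  show "comm_monoid ?L"
  proof (rule comm_monoidI)
    fix x y assume "x \<in> carrier ?L" "y \<in> carrier ?L"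
    then show "x \<otimes>\<^bsub>?L\<^esub> y \<in> carrier ?L"
      by (elim carrier_localizationE) (auto simp: frac intro!: fraction_closed)
  next
    show "\<one>\<^bsub>?L\<^esub> \<in> carrier ?L" by (auto simp: frac)
  next
    fix x y z assume "x \<in> carrier ?L" "y \<in> carrier ?L" "z \<in> carrier ?L"
    then show "x \<otimes>\<^bsub>?L\<^esub> y \<otimes>\<^bsub>?L\<^esub> z = x \<otimes>\<^bsub>?L\<^esub> (y \<otimes>\<^bsub>?L\<^esub> z)"
      by (elim carrier_localizationE) (auto simp: frac m_assoc)
  next
    fix x y assume "x \<in> carrier ?L" "y \<in> carrier ?L"
    then show "x \<otimes>\<^bsub>?L\<^esub> y = y \<otimes>\<^bsub>?L\<^esub> x"
      by (elim carrier_localizationE) (auto simp: frac m_comm)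
  next
    fix x assume "x \<in> carrier ?L"
    then show "\<one>\<^bsub>?L\<^esub> \<otimes>\<^bsub>?L\<^esub> x = x"
      by (elim carrier_localizationE) (auto simp: frac)
  qed
  fix x y z assume "x \<in> carrier ?L" "y \<in> carrier ?L" "z \<in> carrier ?L"
  then show "(x \<oplus>\<^bsub>?L\<^esub> y) \<otimes>\<^bsub>?L\<^esub> z = x \<otimes>\<^bsub>?L\<^esub> z \<oplus>\<^bsub>?L\<^esub> y \<otimes>\<^bsub>?L\<^esub> z"
    by (elim carrier_localizationE, simp add: frac, intro fraction_eqI)
      (simp_all add: S_carrier l_distr r_distr m_ac)
qed

lemma loc_map_hom: "loc_map R S \<in> ring_hom R (localization R S)"
  by (rule ring_hom_memI)
    (auto simp: loc_map_def fraction_mult fraction_add localization_one)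

end

lemma monic_of_degree_iff:
  assumes "cring R" "\<one>\<^bsub>R\<^esub> \<noteq> \<zero>\<^bsub>R\<^esub>"
  shows "monic_of_degree R n F \<longleftrightarrow>
    F \<in> carrier (UP R) \<and> deg R F = n \<and> coeff (UP R) F (deg R F) = \<one>\<^bsub>R\<^esub>"
proof -
  interpret UP_cring R "UP R" by (simp_all add: UP_cring_def assms)
  show ?thesis
    unfolding monic_of_degree_def using assms(2) deg_aboveD[of F n] by (auto simp: le_less)
qed

locale localized_polynomials =
  cring A + U: submonoid U "UP A" + L: ideal I "UP_loc A U" for A (structure) and U I
begin

sublocale UP: UP_cring A "UP A"
  by (simp_all add: UP_cring_def is_cring)

sublocale loc: cring_with_submonoid "UP A" U
  by (intro cring_with_submonoid.intro UP.UP_cring U.submonoid_axioms)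

sublocale L: cring "UP_loc A U"
  by (rule loc.cring_localization)

lemma quotient_cring: "cring (UP_loc A U Quot I)"
  by (rule L.quotient_is_cring[OF L.is_cring])

lemma residue_map_hom: "residue_map A U I \<in> ring_hom (UP A) (UP_loc A U Quot I)"
proof -
  have "residue_map A U I = (+>\<^bsub>UP_loc A U\<^esub>) I \<circ> loc_map (UP A) U"
    by (simp add: fun_eq_iff residue_map_def)
  then show ?thesis
    using ring_hom_trans[OF loc.loc_map_hom L.rcos_ring_hom] by simp
qed

lemma residue_module: "module A (residue_module A U I)"
proof -
  interpret Q: cring "UP_loc A U Quot I" by (rule quotient_cring)
  let ?Q = "UP_loc A U Quot I"
  let ?h = "\<lambda>a. residue_map A U I (monom (UP A) a 0)"
  have "(\<lambda>a. monom (UP A) a 0) \<in> ring_hom A (UP A)"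
    using UP.monom_mult[of _ _ 0 0] by (intro ring_hom_memI) simp_all
  from ring_hom_trans[OF this residue_map_hom] have h: "?h \<in> ring_hom A ?Q"
    by (simp add: comp_def)
  note [simp] = ring_hom_closed[OF h] ring_hom_mult[OF h] ring_hom_add[OF h] ring_hom_one[OF h]
  have "abelian_group (module_via ?h ?Q)"
    by (rule abelian_groupI)
      (auto simp: module_via_def Q.a_ac intro: bexI[where x = "\<ominus>\<^bsub>?Q\<^esub> _"] Q.l_neg)
  then show ?thesis
    unfolding residue_module_def
    by (intro moduleI is_cring)
      (simp_all add: module_via_def Q.l_distr Q.r_distr Q.m_assoc
        del: UP.monom_add UP.monom_one UP.monom_mult)
qed

lemma induced_residue_map_eq:
  assumes F: "F \<in> carrier (UP A)" and gen: "I = Idl\<^bsub>UP_loc A U\<^esub> {loc_map (UP A) U F}"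
    and p: "p \<in> carrier (UP A)"
  shows "induced_residue_map A U I ((Idl\<^bsub>UP A\<^esub> {F}) +>\<^bsub>UP A\<^esub> p) = residue_map A U I p"
proof -
  interpret Q: cring "UP_loc A U Quot I" by (rule quotient_cring)
  interpret J: ideal "Idl\<^bsub>UP A\<^esub> {F}" "UP A" using F by (simp add: UP.genideal_ideal)
  have LF: "loc_map (UP A) U F \<in> carrier (UP_loc A U)"
    using ring_hom_closed[OF loc.loc_map_hom F] .
  have "loc_map (UP A) U F \<in> I"
    using LF unfolding gen by (simp add: L.cgenideal_self flip: L.cgenideal_eq_genideal)
  then have F0: "residue_map A U I F = \<zero>\<^bsub>UP_loc A U Quot I\<^esub>"
    unfolding residue_map_def by (simp add: FactRing_def L.a_rcos_const)
  have eq: "residue_map A U I q = residue_map A U I p"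
    if "q \<in> (Idl\<^bsub>UP A\<^esub> {F}) +>\<^bsub>UP A\<^esub> p" for q
  proof -
    from that obtain f where f: "f \<in> Idl\<^bsub>UP A\<^esub> {F}" "q = f \<oplus>\<^bsub>UP A\<^esub> p"
      unfolding a_r_coset_def' by blast
    then have "f \<in> PIdl\<^bsub>UP A\<^esub> F"
      using UP.P.cgenideal_eq_genideal[OF F] by simp
    with f obtain r where r: "r \<in> carrier (UP A)" "q = (r \<otimes>\<^bsub>UP A\<^esub> F) \<oplus>\<^bsub>UP A\<^esub> p"
      unfolding cgenideal_def by blast
    show ?thesis
      using r F p ring_hom_closed[OF residue_map_hom] F0
      by (simp add: ring_hom_add[OF residue_map_hom] ring_hom_mult[OF residue_map_hom])
  qed
  have "p \<in> (Idl\<^bsub>UP A\<^esub> {F}) +>\<^bsub>UP A\<^esub> p"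
    using p by (rule J.a_rcos_self)
  then have "residue_map A U I ` ((Idl\<^bsub>UP A\<^esub> {F}) +>\<^bsub>UP A\<^esub> p) = {residue_map A U I p}"
    using eq by blast
  then show ?thesis by (simp add: induced_residue_map_def)
qed

end

end

theory Submission
  imports "Jordan_Normal_Form.Char_Poly" Defs
begin

text \<open>
  Write \<open>Q\<close> for the residue ring and \<open>\<rho>\<close> for the canonical map from \<open>A[X]\<close> to \<open>Q\<close>. Everything
  follows from the Cayley--Hamilton theorem in the free \<open>A\<close>-algebra \<open>Q\<close>: each \<open>v \<in> Q\<close> is a root of
  a monic polynomial of degree \<open>n\<close> over \<open>A\<close>, namely the characteristic polynomial of
  multiplication by \<open>v\<close> (\<open>cayley_hamilton\<close>). It is used twice.

  First, \<open>\<rho>\<close> is surjective. As \<open>Q\<close> is generated by the image of \<open>\<rho>\<close> and the inverses \<open>v\<close> of the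
  elements \<open>\<rho> u\<close> with \<open>u \<in> U\<close>, it suffices that such a \<open>v\<close> lies in the image. Multiplying a
  monic equation of \<open>v\<close> by \<open>(\<rho> u)\<^sup>n\<close> shows \<open>1 = \<rho> u \<cdot> w\<close> for some \<open>w\<close> in the image, and then
  \<open>v = v \<cdot> \<rho> u \<cdot> w = w\<close> (\<open>inverse_in_image\<close>).

  Second, the characteristic polynomial \<open>F\<close> of \<open>x = \<rho> X\<close> is monic of degree \<open>n\<close> and \<open>\<rho> F = 0\<close>.
  Division by \<open>F\<close> shows that the \<open>n\<close> powers \<open>1, x, \<dots>, x\<^sup>n\<^sup>-\<^sup>1\<close> span \<open>Q\<close>. Since \<open>Q\<close> is free of
  rank \<open>n\<close>, any \<open>n\<close> spanning elements are independent, because a left inverse of a square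
  matrix is a right inverse (\<open>independent_if_spanning\<close>). Thus no nonzero polynomial with
  vanishing coefficients from \<open>X\<^sup>n\<close> on lies in the kernel of \<open>\<rho>\<close> (\<open>kernel_small_degree\<close>). So \<open>F\<close> is the
  only monic polynomial of degree \<open>n\<close> in the kernel, and, dividing again, it generates the
  kernel. The isomorphism is the homomorphism theorem for \<open>\<rho>\<close>. Finally a fraction \<open>p / s\<close> is in
  \<open>I\<close> exactly if \<open>p\<close> is in the kernel, so \<open>F\<close> generates \<open>I\<close> (\<open>ideal_eq_extension\<close>).

  The two facts about matrices rest on the adjugate identity for determinants. Determinants are
  taken over types of class \<open>comm_ring_1\<close>, whereas \<open>A\<close> is a ring on a carrier set. The
  bridge is a single such type, \<open>ring_family\<close>, that maps onto every commutative ring on \<open>'a\<close>.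
\<close>

section \<open>The product of all commutative rings on a type\<close>

text \<open>The product of all commutative rings with elements of type \<open>'a\<close>. It is a ring under
  componentwise operations, and each of these rings is the image of a component projection, so
  an identity that holds for all elements of a commutative ring type can be projected to each
  of them. The factor \<open>int\<close> makes zero and one distinct, as the class demands, even if \<open>'a\<close>
  carries only zero rings.\<close>

typedef ('a, 'm) ring_family =
  "(UNIV :: int set) \<times> (\<Pi>\<^sub>E A \<in> Collect (cring :: ('a, 'm) ring_scheme \<Rightarrow> bool). carrier A)"
proof
  show "(0, \<lambda>A\<in>Collect cring. \<zero>\<^bsub>A\<^esub>) \<in>
    (UNIV :: int set) \<times> (\<Pi>\<^sub>E A \<in> Collect (cring :: ('a, 'm) ring_scheme \<Rightarrow> bool). carrier A)"
    by (auto simp: cring.cring_simprules)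
qed

setup_lifting type_definition_ring_family

lift_definition component :: "('a, 'm) ring_scheme \<Rightarrow> ('a, 'm) ring_family \<Rightarrow> 'a"
  is "\<lambda>A s. snd s A" .

instantiation ring_family :: (type, type) comm_ring_1
begin

lift_definition zero_ring_family :: "('a, 'b) ring_family"
  is "(0, \<lambda>A\<in>Collect cring. \<zero>\<^bsub>A\<^esub>)"
  by (auto simp: cring.cring_simprules)

lift_definition one_ring_family :: "('a, 'b) ring_family"
  is "(1, \<lambda>A\<in>Collect cring. \<one>\<^bsub>A\<^esub>)"
  by (auto simp: cring.cring_simprules)

lift_definition plus_ring_family :: "('a, 'b) ring_family \<Rightarrow> ('a, 'b) ring_family \<Rightarrow> ('a, 'b) ring_family"
  is "\<lambda>s t. (fst s + fst t, \<lambda>A\<in>Collect cring. snd s A \<oplus>\<^bsub>A\<^esub> snd t A)"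
  by (auto simp: cring.cring_simprules PiE_mem)

lift_definition times_ring_family :: "('a, 'b) ring_family \<Rightarrow> ('a, 'b) ring_family \<Rightarrow> ('a, 'b) ring_family"
  is "\<lambda>s t. (fst s * fst t, \<lambda>A\<in>Collect cring. snd s A \<otimes>\<^bsub>A\<^esub> snd t A)"
  by (auto simp: cring.cring_simprules PiE_mem)

lift_definition uminus_ring_family :: "('a, 'b) ring_family \<Rightarrow> ('a, 'b) ring_family"
  is "\<lambda>s. (- fst s, \<lambda>A\<in>Collect cring. \<ominus>\<^bsub>A\<^esub> snd s A)"
  by (auto simp: cring.cring_simprules PiE_mem)

definition minus_ring_family :: "('a, 'b) ring_family \<Rightarrow> ('a, 'b) ring_family \<Rightarrow> ('a, 'b) ring_family"
  where "minus_ring_family s t = s + - t"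

instance
proof
  fix a b c :: "('a, 'b) ring_family"
  show "a * b * c = a * (b * c)"
    by transfer (clarsimp simp: fun_eq_iff PiE_iff extensional_def cring.cring_simprules(5,11))
  show "a * b = b * a"
    by transfer (clarsimp simp: fun_eq_iff PiE_iff extensional_def cring.cring_simprules(14))
  show "1 * a = a"
    by transfer (clarsimp simp: fun_eq_iff PiE_iff extensional_def cring.cring_simprules(12))
  show "a + b + c = a + (b + c)"
    by transfer (clarsimp simp: fun_eq_iff PiE_iff extensional_def cring.cring_simprules(1,7))
  show "a + b = b + a"
    by transfer (clarsimp simp: fun_eq_iff PiE_iff extensional_def cring.cring_simprules(10))
  show "0 + a = a"
    by transfer (clarsimp simp: fun_eq_iff PiE_iff extensional_def cring.cring_simprules(8))
  show "- a + a = 0"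
    by transfer (clarsimp simp: fun_eq_iff PiE_iff extensional_def cring.cring_simprules(9))
  show "a - b = a + - b"
    by (simp add: minus_ring_family_def)
  show "(a + b) * c = a * c + b * c"
    by transfer (clarsimp simp: fun_eq_iff PiE_iff extensional_def distrib_right cring.cring_simprules(1,5,13))
  show "(0 :: ('a, 'b) ring_family) \<noteq> 1"
    by transfer simp
qed

end

text \<open>Projections carry identities from \<open>ring_family\<close> to a ring. In the other direction, an equation
  between elements of one ring lifts only if their lifts satisfy it in every component; so the
  lift of \<open>a\<close> starts from some \<open>s\<close> that satisfies it everywhere and changes a single component
  to \<open>a\<close>.\<close>

lift_definition set_component ::
    "('a, 'm) ring_scheme \<Rightarrow> 'a \<Rightarrow> ('a, 'm) ring_family \<Rightarrow> ('a, 'm) ring_family"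
  is "\<lambda>A a s. if cring A \<and> a \<in> carrier A then (fst s, (snd s)(A := a)) else s"
  by (auto simp: PiE_iff extensional_def)

context cring
begin

lemma component_closed [simp]: "component R s \<in> carrier R"
  using is_cring by transfer (auto simp: PiE_iff)

lemma component_zero [simp]: "component R 0 = \<zero>"
  and component_one [simp]: "component R 1 = \<one>"
  and component_add [simp]: "component R (s + t) = component R s \<oplus> component R t"
  and component_mult [simp]: "component R (s * t) = component R s \<otimes> component R t"
  and component_uminus [simp]: "component R (- s) = \<ominus> component R s"
  using is_cring by (transfer; simp)+

lemma component_diff [simp]: "component R (s - t) = component R s \<ominus> component R t"
  by (simp add: minus_eq diff_conv_add_uminus del: add_uminus_conv_diff)

lemma component_sum [simp]: "component R (sum f S) = (\<Oplus>i\<in>S. component R (f i))"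
  by (induction S rule: infinite_finite_induct) simp_all

lemma component_set_component [simp]:
  "a \<in> carrier R \<Longrightarrow> component R (set_component R a s) = a"
  using is_cring by transfer simp

lemma set_component_zero: "set_component R \<zero> 0 = 0"
  and set_component_one: "set_component R \<one> 1 = 1"
  using is_cring by (transfer, intro prod_eqI ext, simp, simp add: cring.cring_simprules(1,5))+

lemma set_component_add:
  "a \<in> carrier R \<Longrightarrow> b \<in> carrier R \<Longrightarrow>
    set_component R a s + set_component R b t = set_component R (a \<oplus> b) (s + t)"
  and set_component_mult:
  "a \<in> carrier R \<Longrightarrow> b \<in> carrier R \<Longrightarrow>
    set_component R a s * set_component R b t = set_component R (a \<otimes> b) (s * t)"
  using is_cring by (transfer, intro prod_eqI ext, simp, simp add: cring.cring_simprules(1,5))+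

lemma set_component_sum:
  "f \<in> S \<rightarrow> carrier R \<Longrightarrow>
    (\<Sum>i\<in>S. set_component R (f i) (g i)) = set_component R (\<Oplus>i\<in>S. f i) (sum g S)"
  by (induction S rule: infinite_finite_induct)
    (simp_all add: set_component_zero set_component_add Pi_iff)

section \<open>Matrices over a commutative ring\<close>

text \<open>The identity matrix in all other components makes the lift of \<open>C\<close> a left inverse of the
  lift of \<open>B\<close> as soon as \<open>C\<close> is a left inverse of \<open>B\<close>.\<close>

definition lift_matrix :: "nat \<Rightarrow> (nat \<Rightarrow> nat \<Rightarrow> 'a) \<Rightarrow> ('a, 'b) ring_family mat" where
  "lift_matrix n M = mat n n (\<lambda>(i, j). set_component R (M i j) (if i = j then 1 else 0))"

lemma lift_matrix_carrier [simp]: "lift_matrix n M \<in> carrier_mat n n"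
  and dim_lift_matrix [simp]: "dim_row (lift_matrix n M) = n" "dim_col (lift_matrix n M) = n"
  by (simp_all add: lift_matrix_def)

text \<open>From \<open>C B = 1\<close> the determinant of \<open>C\<close> is a unit, so \<open>C\<close> also has a left inverse \<open>L\<close>, a
  multiple of the adjugate, and \<open>L = L C B = B\<close>.\<close>

lemma left_inverse_imp_right_inverse:
  fixes n :: nat
  assumes C: "\<And>i j. i < n \<Longrightarrow> j < n \<Longrightarrow> C i j \<in> carrier R"
    and B: "\<And>i j. i < n \<Longrightarrow> j < n \<Longrightarrow> B i j \<in> carrier R"
    and inv: "\<And>i j. i < n \<Longrightarrow> j < n \<Longrightarrow> (\<Oplus>k\<in>{..<n}. C i k \<otimes> B k j) = (if i = j then \<one> else \<zero>)"
    and "i < n" "j < n"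
  shows "(\<Oplus>k\<in>{..<n}. B i k \<otimes> C k j) = (if i = j then \<one> else \<zero>)"
proof -
  let ?C = "lift_matrix n C" and ?B = "lift_matrix n B"
  have CB: "?C * ?B = 1\<^sub>m n"
  proof (rule eq_matI)
    fix i j assume ij: "i < dim_row (1\<^sub>m n :: ('a, 'b) ring_family mat)" "j < dim_col (1\<^sub>m n :: ('a, 'b) ring_family mat)"
    then have ij: "i < n" "j < n" by simp_all
    have "(?C * ?B) $$ (i, j) = (\<Sum>k\<in>{..<n}.
        set_component R (C i k) (if i = k then 1 else 0) * set_component R (B k j) (if k = j then 1 else 0))"
      using ij by (simp add: lift_matrix_def scalar_prod_def atLeast0LessThan)
    also have "\<dots> = (\<Sum>k\<in>{..<n}. set_component R (C i k \<otimes> B k j)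
        ((if i = k then 1 else 0) * (if k = j then 1 else 0)))"
      using C B ij by (intro sum.cong refl) (simp add: set_component_mult)
    also have "\<dots> = set_component R (if i = j then \<one> else \<zero>)
        (\<Sum>k\<in>{..<n}. (if i = k then 1 else 0) * (if k = j then 1 else 0))"
      using C B ij by (subst set_component_sum) (auto simp: inv)
    also have "(\<Sum>k\<in>{..<n}. (if i = k then 1 else 0) * (if k = j then 1 else 0))
        = (if i = j then 1 else 0 :: ('a, 'b) ring_family)"
      using ij by (simp add: if_distrib[where f = "\<lambda>x. x * _"] cong: if_cong)
    finally show "(?C * ?B) $$ (i, j) = 1\<^sub>m n $$ (i, j)"
      using ij by (simp add: set_component_zero set_component_one)
  qed simp_all
  have dets: "det ?B * det ?C = 1"
    using arg_cong[OF CB, of det] det_mult[of ?C n ?B] by (simp add: mult.commute)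
  define L where "L = det ?B \<cdot>\<^sub>m adj_mat ?C"
  have L: "L \<in> carrier_mat n n"
    by (simp add: L_def adj_mat)
  have "L * ?C = det ?B \<cdot>\<^sub>m (det ?C \<cdot>\<^sub>m 1\<^sub>m n)"
    using adj_mat[of ?C n] by (simp add: L_def mult_smult_assoc_mat[of _ n n _ n])
  also have "\<dots> = 1\<^sub>m n"
    using dets by (intro eq_matI) auto
  finally have LC: "L * ?C = 1\<^sub>m n" .
  have "L = L * (?C * ?B)"
    using L by (simp add: CB)
  also have "\<dots> = ?B"
    using L by (simp add: LC flip: assoc_mult_mat[of L n n ?C n ?B n])
  finally have BC: "?B * ?C = 1\<^sub>m n"
    using LC by simp
  have "(\<Oplus>k\<in>{..<n}. B i k \<otimes> C k j) = component R ((?B * ?C) $$ (i, j))"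
    using B C \<open>i < n\<close> \<open>j < n\<close>
    by (simp add: lift_matrix_def scalar_prod_def atLeast0LessThan cong: finsum_cong)
  then show ?thesis
    using \<open>i < n\<close> \<open>j < n\<close> by (simp add: BC)
qed


text \<open>If \<open>D\<close> is the adjugate of \<open>X - M\<close> and \<open>\<chi>\<close> the characteristic polynomial of \<open>M\<close>, then
  \<open>D (X - M) = \<chi>\<close>. The lemma is this identity coefficient by coefficient, with \<open>c k\<close> and \<open>N k\<close>
  the coefficients of \<open>\<chi>\<close> and \<open>D\<close> at \<open>X\<^sup>k\<close>; in this form it involves sums and products of elements
  only and can be projected to the given ring.\<close>

lemma characteristic_adjugate:
  fixes n :: nat
  assumes M: "\<And>i j. i < n \<Longrightarrow> j < n \<Longrightarrow> M i j \<in> carrier R"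
  obtains c N K where
    "\<And>k. c k \<in> carrier R" "c n = \<one>" "\<And>k. n < k \<Longrightarrow> c k = \<zero>"
    "\<And>k i j. N k i j \<in> carrier R"
    "\<And>k i j. K \<le> k \<Longrightarrow> i < n \<Longrightarrow> j < n \<Longrightarrow> N k i j = \<zero>"
    "\<And>i j. i < n \<Longrightarrow> j < n \<Longrightarrow>
      (if i = j then c 0 else \<zero>) = \<ominus> (\<Oplus>l\<in>{..<n}. N 0 i l \<otimes> M l j)"
    "\<And>k i j. i < n \<Longrightarrow> j < n \<Longrightarrow>
      (if i = j then c (Suc k) else \<zero>) = N k i j \<ominus> (\<Oplus>l\<in>{..<n}. N (Suc k) i l \<otimes> M l j)"
proof -
  let ?T = "lift_matrix n M"
  define D where "D = adj_mat (char_poly_matrix ?T)"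
  have D: "D \<in> carrier_mat n n" and D_mult: "D * char_poly_matrix ?T = char_poly ?T \<cdot>\<^sub>m 1\<^sub>m n"
    using adj_mat[of "char_poly_matrix ?T" n] by (simp_all add: D_def char_poly_def)
  have entry: "(if i = j then char_poly ?T else 0) =
      pCons 0 (D $$ (i, j)) - (\<Sum>l<n. Polynomial.smult (?T $$ (l, j)) (D $$ (i, l)))"
    if ij: "i < n" "j < n" for i j
  proof -
    have "(if i = j then char_poly ?T else 0) = (D * char_poly_matrix ?T) $$ (i, j)"
      using ij by (simp add: D_mult)
    also have "\<dots> = (\<Sum>l<n. D $$ (i, l) * ((if l = j then [:0, 1:] else 0) + [:- ?T $$ (l, j):]))"
      using ij D by (auto simp: char_poly_matrix_def scalar_prod_def atLeast0LessThan intro!: sum.cong)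
    also have "\<dots> = (\<Sum>l<n. (if l = j then pCons 0 (D $$ (i, l)) else 0) - Polynomial.smult (?T $$ (l, j)) (D $$ (i, l)))"
      by (intro sum.cong refl) (simp add: algebra_simps)
    also have "\<dots> = pCons 0 (D $$ (i, j)) - (\<Sum>l<n. Polynomial.smult (?T $$ (l, j)) (D $$ (i, l)))"
      using ij by (simp add: sum_subtractf)
    finally show ?thesis .
  qed
  define c where "c k = component R (Polynomial.coeff (char_poly ?T) k)" for k
  define N where "N k i j = component R (Polynomial.coeff (D $$ (i, j)) k)" for k i j
  \<comment> \<open>any bound above the degrees of all entries of the adjugate\<close>
  define K where "K = Suc (\<Sum>i<n. \<Sum>j<n. degree (D $$ (i, j)))"
  have chi: "degree (char_poly ?T) = n" "Polynomial.coeff (char_poly ?T) n = 1"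
    using degree_monic_char_poly[of ?T n] by simp_all
  have sum: "component R (\<Sum>l<n. ?T $$ (l, j) * Polynomial.coeff (D $$ (i, l)) k) =
      (\<Oplus>l\<in>{..<n}. N k i l \<otimes> M l j)" if "i < n" "j < n" for i j k
    using that M by (simp add: N_def lift_matrix_def m_comm cong: finsum_cong)
  show thesis
  proof (rule that[of c N K])
    show "c k \<in> carrier R" for k by (simp add: c_def)
    show "c n = \<one>" by (simp add: c_def chi)
    show "c k = \<zero>" if "n < k" for k
      using that by (simp add: c_def chi coeff_eq_0)
    show "N k i j \<in> carrier R" for k i j by (simp add: N_def)
    show "N k i j = \<zero>" if "K \<le> k" "i < n" "j < n" for k i j
    proof -
      have "degree (D $$ (i, j)) \<le> (\<Sum>j<n. degree (D $$ (i, j)))"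
        using that by (intro member_le_sum) auto
      also have "\<dots> \<le> (\<Sum>i<n. \<Sum>j<n. degree (D $$ (i, j)))"
        using that by (intro member_le_sum[where f = "\<lambda>i. \<Sum>j<n. degree (D $$ (i, j))"]) auto
      finally show ?thesis
        using that by (simp add: N_def K_def coeff_eq_0)
    qed
    show "(if i = j then c 0 else \<zero>) = \<ominus> (\<Oplus>l\<in>{..<n}. N 0 i l \<otimes> M l j)"
      if ij: "i < n" "j < n" for i j
    proof -
      have "(if i = j then c 0 else \<zero>) = component R (Polynomial.coeff (if i = j then char_poly ?T else 0) 0)"
        by (simp add: c_def)
      also have "\<dots> = component R (- (\<Sum>l<n. ?T $$ (l, j) * Polynomial.coeff (D $$ (i, l)) 0))"
        unfolding entry[OF ij] by (simp add: Polynomial.coeff_sum)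
      finally show ?thesis
        using sum[OF ij] by (simp del: component_sum)
    qed
    show "(if i = j then c (Suc k) else \<zero>) = N k i j \<ominus> (\<Oplus>l\<in>{..<n}. N (Suc k) i l \<otimes> M l j)"
      if ij: "i < n" "j < n" for k i j
    proof -
      have "(if i = j then c (Suc k) else \<zero>) =
          component R (Polynomial.coeff (if i = j then char_poly ?T else 0) (Suc k))"
        by (simp add: c_def)
      also have "\<dots> = component R (Polynomial.coeff (D $$ (i, j)) k -
          (\<Sum>l<n. ?T $$ (l, j) * Polynomial.coeff (D $$ (i, l)) (Suc k)))"
        unfolding entry[OF ij] by (simp add: Polynomial.coeff_sum)
      finally show ?thesis
        using sum[OF ij] by (simp add: N_def del: component_sum)
    qed
  qed
qed

end

section \<open>Algebras that are free of finite rank\<close>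

lemma (in abelian_monoid) finsum_swap:
  assumes "finite A" "finite B" "\<And>i j. i \<in> A \<Longrightarrow> j \<in> B \<Longrightarrow> f i j \<in> carrier G"
  shows "(\<Oplus>i\<in>A. \<Oplus>j\<in>B. f i j) = (\<Oplus>j\<in>B. \<Oplus>i\<in>A. f i j)"
  using assms(1,3)
proof (induction A)
  case empty
  then show ?case by simp
next
  case (insert a A)
  then have "(\<Oplus>i\<in>insert a A. \<Oplus>j\<in>B. f i j) = (\<Oplus>j\<in>B. f a j) \<oplus> (\<Oplus>j\<in>B. \<Oplus>i\<in>A. f i j)"
    by (subst finsum_insert) auto
  also have "\<dots> = (\<Oplus>j\<in>B. f a j \<oplus> (\<Oplus>i\<in>A. f i j))"
    using insert by (subst finsum_addf) auto
  also have "\<dots> = (\<Oplus>j\<in>B. \<Oplus>i\<in>insert a A. f i j)"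
    using insert by (intro finsum_cong') auto
  finally show ?case .
qed

lemma (in ring) finsum_a_inv:
  assumes "finite I" "f \<in> I \<rightarrow> carrier R"
  shows "(\<Oplus>i\<in>I. \<ominus> f i) = \<ominus> (\<Oplus>i\<in>I. f i)"
  using assms by (induction I) (simp_all add: Pi_iff minus_add)

lemma module_via_simps [simp]:
  "carrier (module_via h B) = carrier B" "\<zero>\<^bsub>module_via h B\<^esub> = \<zero>\<^bsub>B\<^esub>"
  "a \<odot>\<^bsub>module_via h B\<^esub> x = h a \<otimes>\<^bsub>B\<^esub> x" "finsum (module_via h B) = finsum B"
  by (simp_all add: module_via_def fun_eq_iff finsum_def finprod_def)

locale free_algebra = ring_hom_cring R S h
  for R (structure) and S (structure) and h +
  fixes n :: nat and e :: "nat \<Rightarrow> 'c"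
  assumes basis: "is_basis R (module_via h S) n e"
begin

lemma basis_closed [simp]: "i < n \<Longrightarrow> e i \<in> carrier S"
  using basis by (auto simp: is_basis_def)

lemma coordinates:
  assumes "x \<in> carrier S"
  obtains c where "\<And>i. i < n \<Longrightarrow> c i \<in> carrier R" "x = (\<Oplus>\<^bsub>S\<^esub>i\<in>{..<n}. h (c i) \<otimes>\<^bsub>S\<^esub> e i)"
proof -
  have "\<exists>c \<in> {..<n} \<rightarrow> carrier R. x = (\<Oplus>\<^bsub>S\<^esub>i\<in>{..<n}. h (c i) \<otimes>\<^bsub>S\<^esub> e i)"
    using basis assms by (simp add: is_basis_def)
  then show thesis
    using that by (auto simp: Pi_iff)
qed

lemma independent:
  assumes "\<And>i. i < n \<Longrightarrow> c i \<in> carrier R" "(\<Oplus>\<^bsub>S\<^esub>i\<in>{..<n}. h (c i) \<otimes>\<^bsub>S\<^esub> e i) = \<zero>\<^bsub>S\<^esub>" "i < n"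
  shows "c i = \<zero>"
proof -
  have "c \<in> {..<n} \<rightarrow> carrier R"
    using assms(1) by simp
  then show ?thesis
    using basis assms(2,3) by (simp add: is_basis_def)
qed

lemma coordinates_unique:
  assumes c: "\<And>i. i < n \<Longrightarrow> c i \<in> carrier R" and d: "\<And>i. i < n \<Longrightarrow> d i \<in> carrier R"
    and eq: "(\<Oplus>\<^bsub>S\<^esub>i\<in>{..<n}. h (c i) \<otimes>\<^bsub>S\<^esub> e i) = (\<Oplus>\<^bsub>S\<^esub>i\<in>{..<n}. h (d i) \<otimes>\<^bsub>S\<^esub> e i)"
    and i: "i < n"
  shows "c i = d i"
proof -
  have "(\<Oplus>\<^bsub>S\<^esub>i\<in>{..<n}. h (c i \<ominus> d i) \<otimes>\<^bsub>S\<^esub> e i) =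
      (\<Oplus>\<^bsub>S\<^esub>i\<in>{..<n}. h (c i) \<otimes>\<^bsub>S\<^esub> e i \<oplus>\<^bsub>S\<^esub> \<ominus>\<^bsub>S\<^esub> (h (d i) \<otimes>\<^bsub>S\<^esub> e i))"
    using c d by (intro S.finsum_cong')
      (auto simp: R.minus_eq S.l_distr S.l_minus)
  also have "\<dots> = \<zero>\<^bsub>S\<^esub>"
    using c d by (subst S.finsum_addf) (auto simp: eq S.finsum_a_inv S.r_neg)
  finally have "c i \<ominus> d i = \<zero>"
    using c d i by (intro independent[of "\<lambda>i. c i \<ominus> d i"]) auto
  moreover have "c i = (c i \<ominus> d i) \<oplus> d i"
    using c d i by (simp add: R.minus_eq R.a_assoc R.l_neg)
  ultimately show ?thesis
    using d i by simp
qed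

text \<open>Let \<open>M\<close> be the matrix of multiplication by \<open>v\<close>, so that \<open>v e = M e\<close> for the column \<open>e\<close> of basis
  elements. With \<open>c\<close> and \<open>N\<close> as in \<open>characteristic_adjugate\<close>, the relation
  \<open>c\<^sub>k = N\<^sub>k\<^sub>-\<^sub>1 - N\<^sub>k M\<close> becomes \<open>c\<^sub>k e = N\<^sub>k\<^sub>-\<^sub>1 e - v N\<^sub>k e\<close>. Multiplied by \<open>v\<^sup>k\<close> and summed over
  \<open>k\<close>, the right-hand side telescopes to zero. So \<open>\<chi>(v)\<close> annihilates the basis, hence also
  the element one.\<close>

lemma cayley_hamilton:
  assumes v: "v \<in> carrier S"
  obtains c where "\<And>k. c k \<in> carrier R" "c n = \<one>"
    "(\<Oplus>\<^bsub>S\<^esub>k\<in>{..n}. h (c k) \<otimes>\<^bsub>S\<^esub> v [^]\<^bsub>S\<^esub> k) = \<zero>\<^bsub>S\<^esub>"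
proof -
  have "\<exists>c. (\<forall>j<n. c j \<in> carrier R) \<and> v \<otimes>\<^bsub>S\<^esub> e l = (\<Oplus>\<^bsub>S\<^esub>j\<in>{..<n}. h (c j) \<otimes>\<^bsub>S\<^esub> e j)"
    if "l < n" for l
    using that v coordinates[of "v \<otimes>\<^bsub>S\<^esub> e l"] by (metis S.m_closed basis_closed)
  then obtain M where M: "\<And>l j. l < n \<Longrightarrow> j < n \<Longrightarrow> M l j \<in> carrier R"
    and ve: "\<And>l. l < n \<Longrightarrow> v \<otimes>\<^bsub>S\<^esub> e l = (\<Oplus>\<^bsub>S\<^esub>j\<in>{..<n}. h (M l j) \<otimes>\<^bsub>S\<^esub> e j)"
    by metis
  obtain c N K where c: "\<And>k. c k \<in> carrier R" "c n = \<one>" "\<And>k. n < k \<Longrightarrow> c k = \<zero>"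
    and N: "\<And>k i j. N k i j \<in> carrier R"
      "\<And>k i j. K \<le> k \<Longrightarrow> i < n \<Longrightarrow> j < n \<Longrightarrow> N k i j = \<zero>"
    and adj_0: "\<And>i j. i < n \<Longrightarrow> j < n \<Longrightarrow>
      (if i = j then c 0 else \<zero>) = \<ominus> (\<Oplus>l\<in>{..<n}. N 0 i l \<otimes> M l j)"
    and adj_Suc: "\<And>k i j. i < n \<Longrightarrow> j < n \<Longrightarrow>
      (if i = j then c (Suc k) else \<zero>) = N k i j \<ominus> (\<Oplus>l\<in>{..<n}. N (Suc k) i l \<otimes> M l j)"
    by (rule R.characteristic_adjugate[of n M]) (use M in auto)
  define Y where "Y k i = (\<Oplus>\<^bsub>S\<^esub>j\<in>{..<n}. h (N k i j) \<otimes>\<^bsub>S\<^esub> e j)" for k i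
  have Y_closed [simp]: "Y k i \<in> carrier S" for k i
    using N by (auto simp: Y_def)
  have NM [simp]: "(\<Oplus>l\<in>{..<n}. N k i l \<otimes> M l j) \<in> carrier R" if "j < n" for k i j
    using N M that by auto
  have vY: "v \<otimes>\<^bsub>S\<^esub> Y k i = (\<Oplus>\<^bsub>S\<^esub>j\<in>{..<n}. h (\<Oplus>l\<in>{..<n}. N k i l \<otimes> M l j) \<otimes>\<^bsub>S\<^esub> e j)" for k i
  proof -
    have "v \<otimes>\<^bsub>S\<^esub> Y k i = (\<Oplus>\<^bsub>S\<^esub>l\<in>{..<n}. h (N k i l) \<otimes>\<^bsub>S\<^esub> (v \<otimes>\<^bsub>S\<^esub> e l))"
      unfolding Y_def using v N
      by (subst S.finsum_rdistr) (auto intro!: S.finsum_cong' simp: S.m_lcomm)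
    also have "\<dots> = (\<Oplus>\<^bsub>S\<^esub>l\<in>{..<n}. \<Oplus>\<^bsub>S\<^esub>j\<in>{..<n}. h (N k i l \<otimes> M l j) \<otimes>\<^bsub>S\<^esub> e j)"
      using v N M
      by (intro S.finsum_cong' refl)
        (auto simp: ve S.finsum_rdistr S.m_assoc intro!: S.finsum_cong')
    also have "\<dots> = (\<Oplus>\<^bsub>S\<^esub>j\<in>{..<n}. \<Oplus>\<^bsub>S\<^esub>l\<in>{..<n}. h (N k i l \<otimes> M l j) \<otimes>\<^bsub>S\<^esub> e j)"
      using N M by (intro S.finsum_swap) auto
    also have "\<dots> = (\<Oplus>\<^bsub>S\<^esub>j\<in>{..<n}. h (\<Oplus>l\<in>{..<n}. N k i l \<otimes> M l j) \<otimes>\<^bsub>S\<^esub> e j)"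
      using N M by (intro S.finsum_cong' refl) (auto simp: S.finsum_ldistr Pi_iff)
    finally show ?thesis .
  qed
  have unit: "h a \<otimes>\<^bsub>S\<^esub> e i = (\<Oplus>\<^bsub>S\<^esub>j\<in>{..<n}. h (if i = j then a else \<zero>) \<otimes>\<^bsub>S\<^esub> e j)"
    if "a \<in> carrier R" "i < n" for a i
  proof -
    have "(\<Oplus>\<^bsub>S\<^esub>j\<in>{..<n}. h (if i = j then a else \<zero>) \<otimes>\<^bsub>S\<^esub> e j) =
        (\<Oplus>\<^bsub>S\<^esub>j\<in>{..<n}. if i = j then h a \<otimes>\<^bsub>S\<^esub> e j else \<zero>\<^bsub>S\<^esub>)"
      using that by (intro S.finsum_cong') auto
    also have "\<dots> = h a \<otimes>\<^bsub>S\<^esub> e i"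
      using that by (intro S.finsum_singleton) auto
    finally show ?thesis by simp
  qed
  have ce_0: "h (c 0) \<otimes>\<^bsub>S\<^esub> e i = \<ominus>\<^bsub>S\<^esub> (v \<otimes>\<^bsub>S\<^esub> Y 0 i)" if "i < n" for i
  proof -
    have "h (c 0) \<otimes>\<^bsub>S\<^esub> e i =
        (\<Oplus>\<^bsub>S\<^esub>j\<in>{..<n}. \<ominus>\<^bsub>S\<^esub> (h (\<Oplus>l\<in>{..<n}. N 0 i l \<otimes> M l j) \<otimes>\<^bsub>S\<^esub> e j))"
      unfolding unit[OF c(1) that] using that
      by (intro S.finsum_cong') (auto simp: adj_0 S.l_minus simp del: hom_finsum)
    then show ?thesis
      unfolding vY by (subst (asm) S.finsum_a_inv) auto
  qed
  have ce_Suc: "h (c (Suc k)) \<otimes>\<^bsub>S\<^esub> e i = Y k i \<oplus>\<^bsub>S\<^esub> \<ominus>\<^bsub>S\<^esub> (v \<otimes>\<^bsub>S\<^esub> Y (Suc k) i)" if "i < n" for k i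
  proof -
    have "h (c (Suc k)) \<otimes>\<^bsub>S\<^esub> e i = (\<Oplus>\<^bsub>S\<^esub>j\<in>{..<n}. h (N k i j) \<otimes>\<^bsub>S\<^esub> e j \<oplus>\<^bsub>S\<^esub>
        \<ominus>\<^bsub>S\<^esub> (h (\<Oplus>l\<in>{..<n}. N (Suc k) i l \<otimes> M l j) \<otimes>\<^bsub>S\<^esub> e j))"
      unfolding unit[OF c(1) that] using that N
      by (intro S.finsum_cong')
        (auto simp: adj_Suc R.minus_eq S.l_minus S.l_distr simp del: hom_finsum)
    also have "\<dots> = Y k i \<oplus>\<^bsub>S\<^esub> \<ominus>\<^bsub>S\<^esub> (v \<otimes>\<^bsub>S\<^esub> Y (Suc k) i)"
      unfolding vY using N
      by (subst S.finsum_addf) (auto simp: Y_def S.finsum_a_inv simp del: hom_finsum)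
    finally show ?thesis .
  qed
  define p where "p k = (\<Oplus>\<^bsub>S\<^esub>j\<in>{..k}. h (c j) \<otimes>\<^bsub>S\<^esub> v [^]\<^bsub>S\<^esub> j)" for k :: nat
  have p_closed [simp]: "p k \<in> carrier S" for k
    using v c by (auto simp: p_def)
  have p_Suc: "p (Suc k) = h (c (Suc k)) \<otimes>\<^bsub>S\<^esub> v [^]\<^bsub>S\<^esub> Suc k \<oplus>\<^bsub>S\<^esub> p k" for k
    unfolding p_def using v c by (intro S.finsum_Suc) auto
  have telescope: "p k \<otimes>\<^bsub>S\<^esub> e i = \<ominus>\<^bsub>S\<^esub> (v [^]\<^bsub>S\<^esub> Suc k \<otimes>\<^bsub>S\<^esub> Y k i)" if i: "i < n" for k i
  proof (induction k)
    case 0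
    then show ?case
      using i v c by (simp add: p_def ce_0)
  next
    case (Suc k)
    have "p (Suc k) \<otimes>\<^bsub>S\<^esub> e i =
        v [^]\<^bsub>S\<^esub> Suc k \<otimes>\<^bsub>S\<^esub> (h (c (Suc k)) \<otimes>\<^bsub>S\<^esub> e i) \<oplus>\<^bsub>S\<^esub> p k \<otimes>\<^bsub>S\<^esub> e i"
      unfolding p_Suc using i v c by (subst S.l_distr) (simp_all add: S.m_ac del: S.nat_pow_Suc)
    also have "\<dots> = v [^]\<^bsub>S\<^esub> Suc k \<otimes>\<^bsub>S\<^esub> \<ominus>\<^bsub>S\<^esub> (v \<otimes>\<^bsub>S\<^esub> Y (Suc k) i)"
      unfolding ce_Suc[OF i] Suc.IH using v
      by (subst S.a_comm) (simp_all add: S.r_distr S.r_neg1 del: S.nat_pow_Suc)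
    also have "\<dots> = \<ominus>\<^bsub>S\<^esub> (v [^]\<^bsub>S\<^esub> Suc (Suc k) \<otimes>\<^bsub>S\<^esub> Y (Suc k) i)"
      using v by (simp add: S.r_minus S.m_assoc)
    finally show ?case .
  qed
  \<comment> \<open>The partial sums are stationary from \<open>n\<close> on, and at \<open>n + K\<close> the remainder has vanished.\<close>
  have p_n: "p (n + d) = p n" for d
    using v by (induction d) (simp_all add: p_Suc c)
  have "Y (n + K) i = \<zero>\<^bsub>S\<^esub>" if "i < n" for i
    unfolding Y_def using N(2) that by (simp cong: S.finsum_cong)
  then have kills: "p n \<otimes>\<^bsub>S\<^esub> e i = \<zero>\<^bsub>S\<^esub>" if "i < n" for i
    using telescope[OF that, of "n + K"] v that by (simp add: p_n)
  obtain a where a: "\<And>i. i < n \<Longrightarrow> a i \<in> carrier R" "\<one>\<^bsub>S\<^esub> = (\<Oplus>\<^bsub>S\<^esub>i\<in>{..<n}. h (a i) \<otimes>\<^bsub>S\<^esub> e i)"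
    using coordinates[of "\<one>\<^bsub>S\<^esub>"] by auto
  have "p n = p n \<otimes>\<^bsub>S\<^esub> (\<Oplus>\<^bsub>S\<^esub>i\<in>{..<n}. h (a i) \<otimes>\<^bsub>S\<^esub> e i)"
    by (simp flip: a(2))
  also have "\<dots> = (\<Oplus>\<^bsub>S\<^esub>i\<in>{..<n}. h (a i) \<otimes>\<^bsub>S\<^esub> (p n \<otimes>\<^bsub>S\<^esub> e i))"
    using a(1) by (subst S.finsum_rdistr) (auto intro!: S.finsum_cong' simp: S.m_lcomm)
  also have "\<dots> = \<zero>\<^bsub>S\<^esub>"
    using a(1) kills by (simp cong: S.finsum_cong)
  finally show thesis
    using c by (intro that) (auto simp: p_def)
qed

text \<open>Let \<open>B\<close> express the spanning elements \<open>g\<close> by the basis and \<open>C\<close> the basis by \<open>g\<close>. Uniqueness of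
  coordinates gives \<open>C B = 1\<close>, hence \<open>B C = 1\<close>. A relation \<open>a g = 0\<close> means \<open>a B = 0\<close>, and then
  \<open>a = a B C = 0\<close>.\<close>

lemma independent_if_spanning:
  assumes g: "\<And>k. k < n \<Longrightarrow> g k \<in> carrier S"
    and span: "\<And>y. y \<in> carrier S \<Longrightarrow>
      \<exists>c. (\<forall>k<n. c k \<in> carrier R) \<and> y = (\<Oplus>\<^bsub>S\<^esub>k\<in>{..<n}. h (c k) \<otimes>\<^bsub>S\<^esub> g k)"
    and a: "\<And>k. k < n \<Longrightarrow> a k \<in> carrier R"
    and zero: "(\<Oplus>\<^bsub>S\<^esub>k\<in>{..<n}. h (a k) \<otimes>\<^bsub>S\<^esub> g k) = \<zero>\<^bsub>S\<^esub>"
    and "k < n"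
  shows "a k = \<zero>"
proof -
  have "\<exists>c. (\<forall>k<n. c k \<in> carrier R) \<and> e i = (\<Oplus>\<^bsub>S\<^esub>k\<in>{..<n}. h (c k) \<otimes>\<^bsub>S\<^esub> g k)" if "i < n" for i
    using span that by simp
  then obtain C where C: "\<And>i k. i < n \<Longrightarrow> k < n \<Longrightarrow> C i k \<in> carrier R"
    and e: "\<And>i. i < n \<Longrightarrow> e i = (\<Oplus>\<^bsub>S\<^esub>k\<in>{..<n}. h (C i k) \<otimes>\<^bsub>S\<^esub> g k)"
    by metis
  have "\<exists>b. (\<forall>i<n. b i \<in> carrier R) \<and> g k = (\<Oplus>\<^bsub>S\<^esub>i\<in>{..<n}. h (b i) \<otimes>\<^bsub>S\<^esub> e i)" if "k < n" for k
    using that g coordinates[of "g k"] by metis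
  then obtain B where B: "\<And>k i. k < n \<Longrightarrow> i < n \<Longrightarrow> B k i \<in> carrier R"
    and g_eq: "\<And>k. k < n \<Longrightarrow> g k = (\<Oplus>\<^bsub>S\<^esub>i\<in>{..<n}. h (B k i) \<otimes>\<^bsub>S\<^esub> e i)"
    by metis
  have expand: "(\<Oplus>\<^bsub>S\<^esub>k\<in>{..<n}. h (c k) \<otimes>\<^bsub>S\<^esub> g k) =
      (\<Oplus>\<^bsub>S\<^esub>j\<in>{..<n}. h (\<Oplus>k\<in>{..<n}. c k \<otimes> B k j) \<otimes>\<^bsub>S\<^esub> e j)"
    if c: "\<And>k. k < n \<Longrightarrow> c k \<in> carrier R" for c
  proof -
    have "(\<Oplus>\<^bsub>S\<^esub>k\<in>{..<n}. h (c k) \<otimes>\<^bsub>S\<^esub> g k) =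
        (\<Oplus>\<^bsub>S\<^esub>k\<in>{..<n}. \<Oplus>\<^bsub>S\<^esub>j\<in>{..<n}. h (c k \<otimes> B k j) \<otimes>\<^bsub>S\<^esub> e j)"
      using c B by (intro S.finsum_cong' refl)
        (auto simp: g_eq S.finsum_rdistr S.m_assoc intro!: S.finsum_cong')
    also have "\<dots> = (\<Oplus>\<^bsub>S\<^esub>j\<in>{..<n}. \<Oplus>\<^bsub>S\<^esub>k\<in>{..<n}. h (c k \<otimes> B k j) \<otimes>\<^bsub>S\<^esub> e j)"
      using c B by (intro S.finsum_swap) auto
    also have "\<dots> = (\<Oplus>\<^bsub>S\<^esub>j\<in>{..<n}. h (\<Oplus>k\<in>{..<n}. c k \<otimes> B k j) \<otimes>\<^bsub>S\<^esub> e j)"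
      using c B by (intro S.finsum_cong' refl) (auto simp: S.finsum_ldistr Pi_iff)
    finally show ?thesis .
  qed
  have CB: "(\<Oplus>k\<in>{..<n}. C i k \<otimes> B k j) = (if i = j then \<one> else \<zero>)" if "i < n" "j < n" for i j
  proof (rule coordinates_unique[of "\<lambda>j. \<Oplus>k\<in>{..<n}. C i k \<otimes> B k j" "\<lambda>j. if i = j then \<one> else \<zero>"])
    have "(\<Oplus>\<^bsub>S\<^esub>j\<in>{..<n}. h (if i = j then \<one> else \<zero>) \<otimes>\<^bsub>S\<^esub> e j) =
        (\<Oplus>\<^bsub>S\<^esub>j\<in>{..<n}. if i = j then e j else \<zero>\<^bsub>S\<^esub>)"
      by (intro S.finsum_cong') auto
    also have "\<dots> = e i"
      using that by (intro S.finsum_singleton) auto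
    finally show "(\<Oplus>\<^bsub>S\<^esub>j\<in>{..<n}. h (\<Oplus>k\<in>{..<n}. C i k \<otimes> B k j) \<otimes>\<^bsub>S\<^esub> e j) =
        (\<Oplus>\<^bsub>S\<^esub>j\<in>{..<n}. h (if i = j then \<one> else \<zero>) \<otimes>\<^bsub>S\<^esub> e j)"
      using e[OF that(1)] expand[of "C i"] C that by simp
  qed (use that C B in auto)
  have BC: "(\<Oplus>l\<in>{..<n}. B i l \<otimes> C l j) = (if i = j then \<one> else \<zero>)" if "i < n" "j < n" for i j
    using C B CB that by (rule R.left_inverse_imp_right_inverse)
  have aB: "(\<Oplus>i\<in>{..<n}. a i \<otimes> B i l) = \<zero>" if "l < n" for l
    using expand[of a] a B zero that
    by (intro independent[of "\<lambda>l. \<Oplus>i\<in>{..<n}. a i \<otimes> B i l"]) (auto simp del: hom_finsum)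
  have "a k = (\<Oplus>i\<in>{..<n}. if k = i then a i else \<zero>)"
    using a \<open>k < n\<close> by (subst R.finsum_singleton) auto
  also have "\<dots> = (\<Oplus>i\<in>{..<n}. \<Oplus>l\<in>{..<n}. a i \<otimes> B i l \<otimes> C l k)"
  proof (intro R.finsum_cong' refl)
    fix i assume "i \<in> {..<n}"
    then have "(\<Oplus>l\<in>{..<n}. a i \<otimes> B i l \<otimes> C l k) = a i \<otimes> (\<Oplus>l\<in>{..<n}. B i l \<otimes> C l k)"
      using a B C \<open>k < n\<close> by (subst R.finsum_rdistr) (auto intro!: R.finsum_cong' simp: R.m_assoc)
    then show "(if k = i then a i else \<zero>) = (\<Oplus>l\<in>{..<n}. a i \<otimes> B i l \<otimes> C l k)"
      using \<open>i \<in> {..<n}\<close> \<open>k < n\<close> a by (auto simp: BC)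
  qed (use a B C \<open>k < n\<close> in auto)
  also have "\<dots> = (\<Oplus>l\<in>{..<n}. \<Oplus>i\<in>{..<n}. a i \<otimes> B i l \<otimes> C l k)"
    using a B C \<open>k < n\<close> by (intro R.finsum_swap) auto
  also have "\<dots> = (\<Oplus>l\<in>{..<n}. (\<Oplus>i\<in>{..<n}. a i \<otimes> B i l) \<otimes> C l k)"
    using a B C \<open>k < n\<close> by (intro R.finsum_cong' refl) (auto simp: R.finsum_ldistr)
  also have "\<dots> = \<zero>"
    using C \<open>k < n\<close> by (simp add: aB cong: R.finsum_cong)
  finally show ?thesis .
qed

end


section \<open>Polynomials modulo a monic polynomial\<close>

context UP_cring
begin

definition poly_of :: "nat \<Rightarrow> (nat \<Rightarrow> 'a) \<Rightarrow> nat \<Rightarrow> 'a" where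
  "poly_of m c = (\<Oplus>\<^bsub>P\<^esub>k\<in>{..<m}. monom P (c k) k)"

lemma poly_of_closed [simp]: "(\<And>k. k < m \<Longrightarrow> c k \<in> carrier R) \<Longrightarrow> poly_of m c \<in> carrier P"
  by (auto simp: poly_of_def intro!: P.finsum_closed)

lemma coeff_poly_of:
  assumes "\<And>k. k < m \<Longrightarrow> c k \<in> carrier R"
  shows "coeff P (poly_of m c) k = (if k < m then c k else \<zero>)"
proof -
  have "coeff P (poly_of m c) k = (\<Oplus>i\<in>{..<m}. if k = i then c i else \<zero>)"
    unfolding poly_of_def using assms by (subst coeff_finsum) (auto intro!: R.finsum_cong')
  also have "\<dots> = (if k < m then c k else \<zero>)"
  proof (cases "k < m")
    case True
    then show ?thesis using assms by (subst R.finsum_singleton) auto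
  next
    case False
    then have "(\<Oplus>i\<in>{..<m}. if k = i then c i else \<zero>) = (\<Oplus>i\<in>{..<m}. \<zero>)"
      by (intro R.finsum_cong') auto
    then show ?thesis using False by simp
  qed
  finally show ?thesis .
qed

lemma poly_of_coeff:
  assumes "p \<in> carrier P" "\<And>k. m \<le> k \<Longrightarrow> coeff P p k = \<zero>"
  shows "poly_of m (coeff P p) = p"
  using assms by (intro up_eqI) (auto simp: coeff_poly_of not_less)

text \<open>A reformulation of pseudo-division that holds over the zero ring as well. There
  \<open>deg\<close> is constantly zero, so the remainder is bounded by its coefficients instead of its
  degree.\<close>

lemma monic_division:
  assumes F: "F \<in> carrier P" "deg R F \<le> n" "coeff P F n = \<one>" and p: "p \<in> carrier P"
  obtains q r where "q \<in> carrier P" "r \<in> carrier P" "p = q \<otimes>\<^bsub>P\<^esub> F \<oplus>\<^bsub>P\<^esub> r"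
    "\<And>k. n \<le> k \<Longrightarrow> coeff P r k = \<zero>"
proof (cases "\<one> = \<zero>")
  case True
  have "coeff P p k = \<zero>" for k
    using coeff_closed[OF p, of k] R.l_one[of "coeff P p k"] R.l_null[of "coeff P p k"] True by simp
  then show thesis
    using F p by (intro that[of "\<zero>\<^bsub>P\<^esub>" p]) simp_all
next
  case False
  then have deg: "deg R F = n" and F0: "F \<noteq> \<zero>\<^bsub>P\<^esub>"
    using F deg_aboveD[of F n] by (auto simp: le_less)
  obtain q r k where qr: "q \<in> carrier P" "r \<in> carrier P"
    "lcoeff F [^] (k::nat) \<odot>\<^bsub>P\<^esub> p = F \<otimes>\<^bsub>P\<^esub> q \<oplus>\<^bsub>P\<^esub> r" "r = \<zero>\<^bsub>P\<^esub> \<or> deg R r < deg R F"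
    using long_div_theorem[OF F(1) p F0] by blast
  show thesis
  proof (rule that[of q r])
    show "p = q \<otimes>\<^bsub>P\<^esub> F \<oplus>\<^bsub>P\<^esub> r"
      using qr F p by (simp add: deg P.m_comm)
    show "coeff P r k = \<zero>" if "n \<le> k" for k
      using qr that deg_aboveD[of r k] by (auto simp: deg)
  qed (use qr in auto)
qed

end

section \<open>Ring homomorphisms from a polynomial ring to a free algebra\<close>

locale free_polynomial_algebra =
  UP_cring R P + ring_hom_cring P S \<rho> + free: free_algebra R S "\<lambda>a. \<rho> (monom P a 0)" n e
  for R (structure) and P (structure) and S (structure) and \<rho> n e
begin

abbreviation h where "h a \<equiv> \<rho> (monom P a 0)"

abbreviation x where "x \<equiv> \<rho> (monom P \<one> 1)"

lemma image_poly_of: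
  assumes c: "\<And>k. k < m \<Longrightarrow> c k \<in> carrier R"
  shows "\<rho> (poly_of m c) = (\<Oplus>\<^bsub>S\<^esub>k\<in>{..<m}. h (c k) \<otimes>\<^bsub>S\<^esub> x [^]\<^bsub>S\<^esub> k)"
proof -
  have mon: "\<rho> (monom P a k) = h a \<otimes>\<^bsub>S\<^esub> x [^]\<^bsub>S\<^esub> k" if "a \<in> carrier R" for a k
  proof -
    have "monom P a k = monom P a 0 \<otimes>\<^bsub>P\<^esub> monom P \<one> 1 [^]\<^bsub>P\<^esub> k"
      using that monom_mult[of a \<one> 0 k] by (simp add: monom_pow del: monom_mult)
    then show ?thesis
      using that by simp
  qed
  show ?thesis
    unfolding poly_of_def using c
    by (subst hom_finsum) (auto intro!: S.finsum_cong' mon[unfolded One_nat_def])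
qed

lemma monic_annihilator:
  obtains F where "monic_of_degree R n F" "\<rho> F = \<zero>\<^bsub>S\<^esub>"
proof -
  obtain c where c: "\<And>k. c k \<in> carrier R" "c n = \<one>"
    "(\<Oplus>\<^bsub>S\<^esub>k\<in>{..n}. h (c k) \<otimes>\<^bsub>S\<^esub> x [^]\<^bsub>S\<^esub> k) = \<zero>\<^bsub>S\<^esub>"
    by (rule free.cayley_hamilton[of x]) auto
  show thesis
  proof (rule that)
    show "monic_of_degree R n (poly_of (Suc n) c)"
      using c by (auto simp: monic_of_degree_def coeff_poly_of P_def[symmetric] intro!: deg_aboveI)
    show "\<rho> (poly_of (Suc n) c) = \<zero>\<^bsub>S\<^esub>"
      using c by (simp add: image_poly_of lessThan_Suc_atMost)
  qed
qed

text \<open>If \<open>\<Sum>k\<le>n. c\<^sub>k v\<^sup>k = 0\<close> with \<open>c\<^sub>n = 1\<close>, then multiplication by \<open>(\<rho> u)\<^sup>n\<close> gives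
  \<open>1 + \<Sum>k<n. c\<^sub>k (\<rho> u)\<^sup>n\<^sup>-\<^sup>k = 0\<close>. Here \<open>\<rho> u\<close> can be factored out of the sum, which leaves the image of a
  polynomial \<open>g\<close>, and \<open>v = - \<rho> g\<close>.\<close>

lemma inverse_in_image:
  assumes u: "u \<in> carrier P" and v: "v \<in> carrier S" and uv: "\<rho> u \<otimes>\<^bsub>S\<^esub> v = \<one>\<^bsub>S\<^esub>"
  shows "v \<in> \<rho> ` carrier P"
proof -
  obtain c where c: "\<And>k. c k \<in> carrier R" "c n = \<one>"
    "(\<Oplus>\<^bsub>S\<^esub>k\<in>{..n}. h (c k) \<otimes>\<^bsub>S\<^esub> v [^]\<^bsub>S\<^esub> k) = \<zero>\<^bsub>S\<^esub>"
    by (rule free.cayley_hamilton[OF v]) auto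
  define g where "g = (\<Oplus>\<^bsub>P\<^esub>k\<in>{..<n}. monom P (c k) 0 \<otimes>\<^bsub>P\<^esub> u [^]\<^bsub>P\<^esub> (n - Suc k))"
  have g: "g \<in> carrier P"
    using c u by (auto simp: g_def)
  have uv_pow: "\<rho> u [^]\<^bsub>S\<^esub> k \<otimes>\<^bsub>S\<^esub> v [^]\<^bsub>S\<^esub> k = \<one>\<^bsub>S\<^esub>" for k :: nat
    using u v uv by (simp flip: S.nat_pow_distrib)
  have split: "\<rho> u [^]\<^bsub>S\<^esub> n = \<rho> u [^]\<^bsub>S\<^esub> (n - k) \<otimes>\<^bsub>S\<^esub> \<rho> u [^]\<^bsub>S\<^esub> k" if "k \<le> n" for k
    using that u by (simp add: S.nat_pow_mult)
  have "\<zero>\<^bsub>S\<^esub> = \<rho> u [^]\<^bsub>S\<^esub> n \<otimes>\<^bsub>S\<^esub> (\<Oplus>\<^bsub>S\<^esub>k\<in>{..n}. h (c k) \<otimes>\<^bsub>S\<^esub> v [^]\<^bsub>S\<^esub> k)"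
    using u c(3) by simp
  also have "\<dots> = (\<Oplus>\<^bsub>S\<^esub>k\<in>{..n}. h (c k) \<otimes>\<^bsub>S\<^esub> \<rho> u [^]\<^bsub>S\<^esub> (n - k))"
  proof -
    have "\<rho> u [^]\<^bsub>S\<^esub> n \<otimes>\<^bsub>S\<^esub> (h (c k) \<otimes>\<^bsub>S\<^esub> v [^]\<^bsub>S\<^esub> k) = h (c k) \<otimes>\<^bsub>S\<^esub> \<rho> u [^]\<^bsub>S\<^esub> (n - k)"
      if "k \<le> n" for k
    proof -
      have "\<rho> u [^]\<^bsub>S\<^esub> n \<otimes>\<^bsub>S\<^esub> (h (c k) \<otimes>\<^bsub>S\<^esub> v [^]\<^bsub>S\<^esub> k) =
          h (c k) \<otimes>\<^bsub>S\<^esub> \<rho> u [^]\<^bsub>S\<^esub> (n - k) \<otimes>\<^bsub>S\<^esub> (\<rho> u [^]\<^bsub>S\<^esub> k \<otimes>\<^bsub>S\<^esub> v [^]\<^bsub>S\<^esub> k)"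
        unfolding split[OF that] using u v c(1) by (simp add: S.m_ac del: hom_pow hom_mult)
      then show ?thesis
        using u c(1) by (simp add: uv_pow)
    qed
    then show ?thesis
      using u v c(1) by (subst S.finsum_rdistr) (auto intro!: S.finsum_cong')
  qed
  also have "\<dots> = \<one>\<^bsub>S\<^esub> \<oplus>\<^bsub>S\<^esub> (\<Oplus>\<^bsub>S\<^esub>k\<in>{..<n}. h (c k) \<otimes>\<^bsub>S\<^esub> \<rho> u [^]\<^bsub>S\<^esub> (n - k))"
    using u c(1,2) by (simp add: ivl_disj_un_singleton(2)[symmetric] Pi_iff)
  also have "(\<Oplus>\<^bsub>S\<^esub>k\<in>{..<n}. h (c k) \<otimes>\<^bsub>S\<^esub> \<rho> u [^]\<^bsub>S\<^esub> (n - k)) = \<rho> u \<otimes>\<^bsub>S\<^esub> \<rho> g"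
  proof -
    have "h (c k) \<otimes>\<^bsub>S\<^esub> \<rho> u [^]\<^bsub>S\<^esub> (n - k) = \<rho> u \<otimes>\<^bsub>S\<^esub> \<rho> (monom P (c k) 0 \<otimes>\<^bsub>P\<^esub> u [^]\<^bsub>P\<^esub> (n - Suc k))"
      if "k < n" for k
    proof -
      have "n - k = Suc (n - Suc k)" using that by simp
      then show ?thesis
        using u c(1) by (simp add: S.m_ac)
    qed
    then show ?thesis
      unfolding g_def using u c(1)
      by (subst hom_finsum) (auto simp: S.finsum_rdistr simp del: hom_mult hom_pow intro!: S.finsum_cong')
  qed
  finally have "\<one>\<^bsub>S\<^esub> \<oplus>\<^bsub>S\<^esub> \<rho> u \<otimes>\<^bsub>S\<^esub> \<rho> g = \<zero>\<^bsub>S\<^esub>"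
    by (rule sym)
  then have zero: "v \<otimes>\<^bsub>S\<^esub> (\<one>\<^bsub>S\<^esub> \<oplus>\<^bsub>S\<^esub> \<rho> u \<otimes>\<^bsub>S\<^esub> \<rho> g) = \<zero>\<^bsub>S\<^esub>"
    using v by simp
  have "v \<oplus>\<^bsub>S\<^esub> \<rho> g = \<zero>\<^bsub>S\<^esub>"
  proof -
    have "v \<otimes>\<^bsub>S\<^esub> (\<one>\<^bsub>S\<^esub> \<oplus>\<^bsub>S\<^esub> \<rho> u \<otimes>\<^bsub>S\<^esub> \<rho> g) = v \<oplus>\<^bsub>S\<^esub> (\<rho> u \<otimes>\<^bsub>S\<^esub> v) \<otimes>\<^bsub>S\<^esub> \<rho> g"
      using u v g by (simp add: S.r_distr S.m_ac)
    with zero show ?thesis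
      using g by (simp add: uv)
  qed
  then have "v = \<rho> (\<ominus>\<^bsub>P\<^esub> g)"
    using v g by (simp add: S.minus_equality[of v "\<rho> g"])
  then show ?thesis
    using g by blast
qed

context
  assumes surj: "\<rho> ` carrier P = carrier S"
begin

lemma powers_span:
  assumes "y \<in> carrier S"
  shows "\<exists>c. (\<forall>k<n. c k \<in> carrier R) \<and> y = (\<Oplus>\<^bsub>S\<^esub>k\<in>{..<n}. h (c k) \<otimes>\<^bsub>S\<^esub> x [^]\<^bsub>S\<^esub> k)"
proof -
  obtain F where F: "monic_of_degree R n F" "\<rho> F = \<zero>\<^bsub>S\<^esub>"
    by (rule monic_annihilator)
  obtain p where p: "p \<in> carrier P" "y = \<rho> p"
    using assms surj by blast
  obtain q r where qr: "q \<in> carrier P" "r \<in> carrier P" "p = q \<otimes>\<^bsub>P\<^esub> F \<oplus>\<^bsub>P\<^esub> r"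
    "\<And>k. n \<le> k \<Longrightarrow> coeff P r k = \<zero>"
    using F p by (auto simp: monic_of_degree_def P_def[symmetric] elim: monic_division[of F n p])
  have "F \<in> carrier P"
    using F(1) by (simp add: monic_of_degree_def P_def)
  then have "y = \<rho> (poly_of n (coeff P r))"
    using F(2) qr p by (simp add: poly_of_coeff)
  then show ?thesis
    using qr by (intro exI[of _ "coeff P r"]) (simp add: image_poly_of)
qed

text \<open>The spanning powers \<open>1, x, \<dots>, x\<^sup>n\<^sup>-\<^sup>1\<close> are independent, since their number is the rank.\<close>

lemma kernel_small_degree:
  assumes r: "r \<in> carrier P" "\<And>k. n \<le> k \<Longrightarrow> coeff P r k = \<zero>" and "\<rho> r = \<zero>\<^bsub>S\<^esub>"
  shows "r = \<zero>\<^bsub>P\<^esub>"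
proof (rule up_eqI)
  fix k
  have "(\<Oplus>\<^bsub>S\<^esub>k\<in>{..<n}. h (coeff P r k) \<otimes>\<^bsub>S\<^esub> x [^]\<^bsub>S\<^esub> k) = \<zero>\<^bsub>S\<^esub>"
    using assms image_poly_of[of n "coeff P r"] by (simp add: poly_of_coeff)
  then have "coeff P r k = \<zero>" if "k < n"
    using that r powers_span by (intro free.independent_if_spanning[of "\<lambda>k. x [^]\<^bsub>S\<^esub> k" "coeff P r" k]) auto
  then show "coeff P r k = coeff P \<zero>\<^bsub>P\<^esub> k"
    using r(2)[of k] by (cases "k < n") auto
qed (use r in auto)

lemma kernel_eq_genideal:
  assumes F: "monic_of_degree R n F" "\<rho> F = \<zero>\<^bsub>S\<^esub>"
  shows "a_kernel P S \<rho> = Idl\<^bsub>P\<^esub> {F}"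
proof -
  have F': "F \<in> carrier P" "deg R F \<le> n" "coeff P F n = \<one>"
    using F by (auto simp: monic_of_degree_def P_def)
  have "p \<in> PIdl\<^bsub>P\<^esub> F" if p: "p \<in> carrier P" "\<rho> p = \<zero>\<^bsub>S\<^esub>" for p
  proof -
    obtain q r where qr: "q \<in> carrier P" "r \<in> carrier P" "p = q \<otimes>\<^bsub>P\<^esub> F \<oplus>\<^bsub>P\<^esub> r"
      "\<And>k. n \<le> k \<Longrightarrow> coeff P r k = \<zero>"
      by (rule monic_division[OF F' p(1)]) blast
    have "\<rho> r = \<zero>\<^bsub>S\<^esub>"
      using qr(1-3) p(2) F' F(2) by simp
    then have "p = q \<otimes>\<^bsub>P\<^esub> F"
      using kernel_small_degree[of r] qr F' by simp
    then show ?thesis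
      using qr(1) by (auto simp: cgenideal_def)
  qed
  moreover have "p \<in> carrier P \<and> \<rho> p = \<zero>\<^bsub>S\<^esub>" if "p \<in> PIdl\<^bsub>P\<^esub> F" for p
    using that F' F(2) by (auto simp: cgenideal_def)
  ultimately have "a_kernel P S \<rho> = PIdl\<^bsub>P\<^esub> F"
    unfolding a_kernel_def' by blast
  then show ?thesis
    using P.cgenideal_eq_genideal[OF F'(1)] by simp
qed

lemma monic_annihilator_unique:
  assumes F: "monic_of_degree R n F" "\<rho> F = \<zero>\<^bsub>S\<^esub>" and G: "monic_of_degree R n G" "\<rho> G = \<zero>\<^bsub>S\<^esub>"
  shows "F = G"
proof -
  have F': "F \<in> carrier P" "deg R F \<le> n" "coeff P F n = \<one>"
    and G': "G \<in> carrier P" "deg R G \<le> n" "coeff P G n = \<one>"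
    using F G by (auto simp: monic_of_degree_def P_def)
  have "coeff P (F \<ominus>\<^bsub>P\<^esub> G) k = \<zero>" if "n \<le> k" for k
    using that F' G' deg_aboveD[of F k] deg_aboveD[of G k] by (cases "k = n") (auto simp: R.minus_eq R.r_neg)
  then have "F \<ominus>\<^bsub>P\<^esub> G = \<zero>\<^bsub>P\<^esub>"
    using F' G' F(2) G(2) by (intro kernel_small_degree) (auto simp: P.minus_eq)
  moreover have "F = (F \<ominus>\<^bsub>P\<^esub> G) \<oplus>\<^bsub>P\<^esub> G"
    using F' G' by (simp add: P.minus_eq P.a_assoc P.l_neg)
  ultimately show ?thesis
    using G' by simp
qed

end
end

section \<open>Residue rings of a localized polynomial ring\<close>

context localized_polynomials
begin

text \<open>The class of \<open>p / s\<close> is the product of the images of \<open>p\<close> and of a polynomial that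
  represents the inverse of the image of \<open>s\<close>.\<close>

lemma residue_map_surj:
  assumes inv: "\<And>u v. u \<in> carrier (UP A) \<Longrightarrow> v \<in> carrier (UP_loc A U Quot I) \<Longrightarrow>
      residue_map A U I u \<otimes>\<^bsub>UP_loc A U Quot I\<^esub> v = \<one>\<^bsub>UP_loc A U Quot I\<^esub> \<Longrightarrow>
      v \<in> residue_map A U I ` carrier (UP A)"
  shows "residue_map A U I ` carrier (UP A) = carrier (UP_loc A U Quot I)"
proof
  let ?L = "UP_loc A U" and ?Q = "UP_loc A U Quot I"
  interpret Q: cring ?Q by (rule quotient_cring)
  note closed = ring_hom_closed[OF residue_map_hom]
  show "residue_map A U I ` carrier (UP A) \<subseteq> carrier ?Q"
    using closed by blast
  show "carrier ?Q \<subseteq> residue_map A U I ` carrier (UP A)"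
  proof
    fix y assume "y \<in> carrier ?Q"
    then obtain z where z: "z \<in> carrier ?L" "y = I +>\<^bsub>?L\<^esub> z"
      by (auto simp: FactRing_def A_RCOSETS_def')
    then obtain p s where ps: "p \<in> carrier (UP A)" "s \<in> U" "z = fraction (UP A) U p s"
      by (elim loc.carrier_localizationE)
    have s: "s \<in> carrier (UP A)"
      using ps(2) by (rule loc.S_carrier)
    define v where "v = I +>\<^bsub>?L\<^esub> fraction (UP A) U \<one>\<^bsub>UP A\<^esub> s"
    have frac: "fraction (UP A) U \<one>\<^bsub>UP A\<^esub> s \<in> carrier ?L"
      using ps(2) by blast
    then have v: "v \<in> carrier ?Q"
      unfolding v_def using ring_hom_closed[OF L.rcos_ring_hom] by blast
    have mult: "residue_map A U I q \<otimes>\<^bsub>?Q\<^esub> v = I +>\<^bsub>?L\<^esub> fraction (UP A) U q s"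
      if q: "q \<in> carrier (UP A)" for q
    proof -
      have "loc_map (UP A) U q \<in> carrier ?L"
        using ring_hom_closed[OF loc.loc_map_hom q] .
      then have "residue_map A U I q \<otimes>\<^bsub>?Q\<^esub> v =
          I +>\<^bsub>?L\<^esub> (loc_map (UP A) U q \<otimes>\<^bsub>?L\<^esub> fraction (UP A) U \<one>\<^bsub>UP A\<^esub> s)"
        unfolding residue_map_def v_def using ring_hom_mult[OF L.rcos_ring_hom] frac by simp
      then show ?thesis
        using q ps(2) s by (simp add: loc_map_def loc.fraction_mult)
    qed
    have "fraction (UP A) U s s = \<one>\<^bsub>?L\<^esub>"
      unfolding loc.localization_one using s ps(2) by (intro loc.fraction_eqI) (auto simp: UP.P.m_comm)
    then have "residue_map A U I s \<otimes>\<^bsub>?Q\<^esub> v = \<one>\<^bsub>?Q\<^esub>"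
      using mult[OF s] ring_hom_one[OF L.rcos_ring_hom] by simp
    then obtain g where g: "g \<in> carrier (UP A)" "v = residue_map A U I g"
      using inv[OF s v] by blast
    have "y = residue_map A U I (p \<otimes>\<^bsub>UP A\<^esub> g)"
      using mult[OF ps(1)] z ps g ring_hom_mult[OF residue_map_hom ps(1) g(1)] by simp
    then show "y \<in> residue_map A U I ` carrier (UP A)"
      using ps(1) g(1) by blast
  qed
qed

lemma residue_map_eq_zero_iff:
  assumes "p \<in> carrier (UP A)"
  shows "residue_map A U I p = \<zero>\<^bsub>UP_loc A U Quot I\<^esub> \<longleftrightarrow> loc_map (UP A) U p \<in> I"
  using L.a_rcos_const[of "loc_map (UP A) U p"] L.a_rcos_self[of "loc_map (UP A) U p"]
    ring_hom_closed[OF loc.loc_map_hom assms]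
  unfolding residue_map_def by (auto simp: FactRing_def)

text \<open>Every ideal of a localization is generated by its contraction: if \<open>p / s\<close> is in \<open>I\<close>, then so is
  \<open>p / 1\<close>, hence \<open>p = q F\<close> and \<open>p / s\<close> is the multiple \<open>q / s\<close> of \<open>F / 1\<close>.\<close>

lemma ideal_eq_extension:
  assumes F: "F \<in> carrier (UP A)"
    and ker: "a_kernel (UP A) (UP_loc A U Quot I) (residue_map A U I) = Idl\<^bsub>UP A\<^esub> {F}"
  shows "I = Idl\<^bsub>UP_loc A U\<^esub> {loc_map (UP A) U F}"
proof
  let ?L = "UP_loc A U"
  have ker': "loc_map (UP A) U p \<in> I \<longleftrightarrow> p \<in> PIdl\<^bsub>UP A\<^esub> F" if p: "p \<in> carrier (UP A)" for p
  proof -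
    have "loc_map (UP A) U p \<in> I \<longleftrightarrow>
        p \<in> a_kernel (UP A) (UP_loc A U Quot I) (residue_map A U I)"
      using p by (simp add: a_kernel_def' residue_map_eq_zero_iff)
    then show ?thesis
      by (simp add: ker UP.P.cgenideal_eq_genideal[OF F])
  qed
  have LF: "loc_map (UP A) U F \<in> carrier ?L"
    using ring_hom_closed[OF loc.loc_map_hom F] .
  have "loc_map (UP A) U F \<in> I"
    using ker'[OF F] UP.P.cgenideal_self[OF F] by simp
  then show "Idl\<^bsub>?L\<^esub> {loc_map (UP A) U F} \<subseteq> I"
    by (intro L.genideal_minimal) (auto intro: L.ideal_axioms)
  show "I \<subseteq> Idl\<^bsub>?L\<^esub> {loc_map (UP A) U F}"
  proof
    fix y assume y: "y \<in> I"
    then obtain p s where ps: "p \<in> carrier (UP A)" "s \<in> U" "y = fraction (UP A) U p s"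
      using L.a_Hcarr loc.carrier_localizationE by metis
    have s: "s \<in> carrier (UP A)"
      using ps(2) by (rule loc.S_carrier)
    have "loc_map (UP A) U s \<otimes>\<^bsub>?L\<^esub> y = fraction (UP A) U (s \<otimes>\<^bsub>UP A\<^esub> p) s"
      using s ps by (simp add: loc_map_def loc.fraction_mult)
    also have "\<dots> = loc_map (UP A) U p"
      unfolding loc_map_def using s ps by (intro loc.fraction_eqI) (auto simp: UP.P.m_comm)
    finally have "loc_map (UP A) U p \<in> I"
      using L.I_l_closed[OF y ring_hom_closed[OF loc.loc_map_hom s]] by simp
    then obtain q where q: "q \<in> carrier (UP A)" "p = q \<otimes>\<^bsub>UP A\<^esub> F"
      using ker' ps(1) by (auto simp: cgenideal_def)
    then have "y = fraction (UP A) U q s \<otimes>\<^bsub>?L\<^esub> loc_map (UP A) U F"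
      using ps s F by (simp add: loc_map_def loc.fraction_mult)
    then have "y \<in> PIdl\<^bsub>?L\<^esub> (loc_map (UP A) U F)"
      using q(1) ps(2) by (auto simp: cgenideal_def)
    then show "y \<in> Idl\<^bsub>?L\<^esub> {loc_map (UP A) U F}"
      using L.cgenideal_eq_genideal[OF LF] by simp
  qed
qed

end

theorem theorem4p5:
  fixes A :: "('a, 'm) ring_scheme"
    and U :: "(nat \<Rightarrow> 'a) set"
    and I :: "((nat \<Rightarrow> 'a) \<times> (nat \<Rightarrow> 'a)) set set"
    and n :: nat
  assumes "cring A"
    and "submonoid U (UP A)"
    and "ideal I (UP_loc A U)"
    and "free_of_rank A (residue_module A U I) n"
  shows "(\<exists>!F. monic_of_degree A n F \<and> I = Idl\<^bsub>UP_loc A U\<^esub> {loc_map (UP A) U F}) \<and>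
    (\<forall>F. monic_of_degree A n F \<and> I = Idl\<^bsub>UP_loc A U\<^esub> {loc_map (UP A) U F} \<longrightarrow>
       induced_residue_map A U I \<in> ring_iso (UP A Quot (Idl\<^bsub>UP A\<^esub> {F})) (UP_loc A U Quot I))"
proof -
  interpret localized_polynomials A U I
    using assms by (simp add: localized_polynomials_def)
  let ?P = "UP A" and ?L = "UP_loc A U" and ?Q = "UP_loc A U Quot I" and ?\<rho> = "residue_map A U I"
  interpret Q: cring ?Q by (rule quotient_cring)
  interpret \<rho>: ring_hom_ring ?P ?Q ?\<rho>
    using UP.UP_ring Q.ring_axioms residue_map_hom by (rule ring_hom_ringI2)
  have const: "(\<lambda>a. monom ?P a 0) \<in> ring_hom A ?P"
    using UP.const_ring_hom .
  from assms(4) obtain e where e: "is_basis A (residue_module A U I) n e"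
    by (auto simp: free_of_rank_def)
  interpret free_polynomial_algebra A ?P ?Q ?\<rho> n e
  proof unfold_locales
    show "(\<lambda>a. ?\<rho> (monom ?P a 0)) \<in> ring_hom A ?Q"
      using ring_hom_trans[OF const residue_map_hom] by (simp add: comp_def)
    show "is_basis A (module_via (\<lambda>a. ?\<rho> (monom ?P a 0)) ?Q) n e"
      using e by (simp add: residue_module_def)
  qed (rule residue_map_hom)
  have surj: "?\<rho> ` carrier ?P = carrier ?Q"
    by (rule residue_map_surj) (rule inverse_in_image)
  have in_carrier: "F \<in> carrier ?P" if "monic_of_degree A n F" for F
    using that by (simp add: monic_of_degree_def)
  have generator_iff: "I = Idl\<^bsub>?L\<^esub> {loc_map ?P U F} \<longleftrightarrow> ?\<rho> F = \<zero>\<^bsub>?Q\<^esub>"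
    if F: "monic_of_degree A n F" for F
  proof
    assume "?\<rho> F = \<zero>\<^bsub>?Q\<^esub>"
    then show "I = Idl\<^bsub>?L\<^esub> {loc_map ?P U F}"
      using F in_carrier by (intro ideal_eq_extension kernel_eq_genideal surj)
  next
    assume I: "I = Idl\<^bsub>?L\<^esub> {loc_map ?P U F}"
    have "loc_map ?P U F \<in> Idl\<^bsub>?L\<^esub> {loc_map ?P U F}"
      using ring_hom_closed[OF loc.loc_map_hom in_carrier[OF F]]
      by (intro L.genideal_self') auto
    then show "?\<rho> F = \<zero>\<^bsub>?Q\<^esub>"
      using residue_map_eq_zero_iff[OF in_carrier[OF F]] I by simp
  qed
  have "\<exists>!F. monic_of_degree A n F \<and> ?\<rho> F = \<zero>\<^bsub>?Q\<^esub>"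
    using monic_annihilator_unique[OF surj] by (metis monic_annihilator)
  moreover have "induced_residue_map A U I \<in> ring_iso (?P Quot (Idl\<^bsub>?P\<^esub> {F})) ?Q"
    if "monic_of_degree A n F" "?\<rho> F = \<zero>\<^bsub>?Q\<^esub>" for F
  proof -
    have "induced_residue_map A U I = (\<lambda>X. the_elem (?\<rho> ` X))"
      by (simp add: fun_eq_iff induced_residue_map_def)
    then show ?thesis
      using \<rho>.FactRing_iso_set[OF surj] kernel_eq_genideal[OF surj that] by simp
  qed
  ultimately show ?thesis
    using generator_iff by metis
qed

end
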